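(* Let $n\ge 3$ and let $f\in\mathbf{Bir}_{2,2}(\mathbb P^{n-1})$ be a (complex) quadro-quadric Cremona transformation. Let $X_f\subset\mathbb P^{2n+1}$ be the associated $n$-dimensional variety, through a general point $p\in\mathbb P^{2n+1}$ of which there passes a unique secant line $\ell_p=\langle a_p,b_p\rangle$ to $X_f$, with $\{a_p,b_p\}$ a uniquely determined unordered pair of distinct points of $X_f$. For general $p$ let $p'\in\ell_p$ be the harmonic conjugate of $p$ with respect to $a_p,b_p$, i.e. the unique point of $\ell_p$ such that the cross-ratio satisfies $\mathrm{Cr}(a_p,b_p;p,p')=-1$. Then the map $$\Phi_f:\mathbb P^{2n+1}\dashrightarrow\mathbb P^{2n+1},\qquad p\longmapsto p'$$ is an involutorial cubo-cubic Cremona transformation of $\mathbb P^{2n+1}$ (that is, a birational involution of bidegree $(3,3)$).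
   Context: Everything is over $\mathbb C$. $\mathbf{Bir}_{2,2}(\mathbb P^{n-1})$ is the set of Cremona transformations of $\mathbb P^{n-1}$ of bidegree $(2,2)$: given by quadratic forms without common factor, with inverse also given by quadratic forms without common factor. A Cremona transformation has bidegree $(3,3)$ if it and its inverse are given by cubic forms without common factor. Definition of $X_f$: let $F,G:\mathbb C^n\to\mathbb C^n$ be quadratic homogeneous lifts (components without common factor) of $f$ and $f^{-1}$, and let $N$ be the cubic form on $\mathbb C^n$ with $G(F(\boldsymbol x))=N(\boldsymbol x)\boldsymbol x$ for all $\boldsymbol x$. Then $X_f\subset\mathbb P^{2n+1}$ is the closure of the image of the affine parametrization $\mathbb C^n\ni\boldsymbol x\mapsto[1:\boldsymbol x:F(\boldsymbol x):N(\boldsymbol x)]$. It is known that $X_f$ is an irreducible $n$-dimensional variety with one apparent double point (OADP): a general point of $\mathbb P^{2n+1}$ lies on exactly one secant line to $X_f$. *)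

theory Defs
  imports "HOL-Analysis.Analysis"
begin

section \<open>Forms on complex coordinate spaces\<close>

text \<open>Since the ground field is infinite, polynomials in the coordinates are identified with
  the functions they define. (The library's polynomial functions are real polynomial and would
  include complex conjugates.)\<close>

inductive poly_fun :: "(complex ^ 'n \<Rightarrow> complex) \<Rightarrow> bool" where
  const: "poly_fun (\<lambda>x. c)"
| coord: "poly_fun (\<lambda>x. x $ i)"
| add: "poly_fun P \<Longrightarrow> poly_fun Q \<Longrightarrow> poly_fun (\<lambda>x. P x + Q x)"
| mult: "poly_fun P \<Longrightarrow> poly_fun Q \<Longrightarrow> poly_fun (\<lambda>x. P x * Q x)"

definition form :: "nat \<Rightarrow> (complex ^ 'n \<Rightarrow> complex) \<Rightarrow> bool" where
  "form d P \<longleftrightarrow> poly_fun P \<and> (\<forall>c x. P (c *s x) = c ^ d * P x)"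

text \<open>The zero tuple does have a common factor according to this definition: every coordinate
  function divides it.\<close>

definition no_common_factor :: "(complex ^ 'n \<Rightarrow> complex ^ 'm) \<Rightarrow> bool" where
  "no_common_factor F \<longleftrightarrow>
     (\<forall>h Q. poly_fun h \<and> (\<forall>i. poly_fun (Q i)) \<and> (\<forall>i x. F x $ i = h x * Q i x)
        \<longrightarrow> (\<exists>c. \<forall>x. h x = c))"


section \<open>Projective space and its Zariski topology\<close>

text \<open>The elements of the type \<open>'n cproj\<close> are the points of the projective space of
  dimension \<open>CARD('n) - 1\<close>, that is, nonzero vectors up to scaling. The term \<open>proj_pt x\<close> is
  meaningful only for \<open>x \<noteq> 0\<close>.\<close>

quotient_type (overloaded) 'n cproj = "complex ^ ('n::finite)" /
  partial: "\<lambda>x y. x \<noteq> 0 \<and> (\<exists>c. c \<noteq> 0 \<and> y = c *s x)"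
proof (rule part_equivpI)
  show "\<exists>x :: complex ^ 'n. x \<noteq> 0 \<and> (\<exists>c. c \<noteq> 0 \<and> x = c *s x)"
    by (rule exI[of _ "axis undefined 1"]) (auto intro!: exI[of _ 1])
  show "symp (\<lambda>x y :: complex ^ 'n. x \<noteq> 0 \<and> (\<exists>c. c \<noteq> 0 \<and> y = c *s x))"
  proof (rule sympI)
    fix x y :: "complex ^ 'n"
    assume "x \<noteq> 0 \<and> (\<exists>c. c \<noteq> 0 \<and> y = c *s x)"
    then obtain c where "x \<noteq> 0" "c \<noteq> 0" "y = c *s x" by blast
    then show "y \<noteq> 0 \<and> (\<exists>c. c \<noteq> 0 \<and> x = c *s y)"
      by (auto intro!: exI[of _ "inverse c"])
  qed
  show "transp (\<lambda>x y :: complex ^ 'n. x \<noteq> 0 \<and> (\<exists>c. c \<noteq> 0 \<and> y = c *s x))"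
  proof (rule transpI)
    fix x y z :: "complex ^ 'n"
    assume "x \<noteq> 0 \<and> (\<exists>c. c \<noteq> 0 \<and> y = c *s x)" and "y \<noteq> 0 \<and> (\<exists>c. c \<noteq> 0 \<and> z = c *s y)"
    then obtain c d where "x \<noteq> 0" "c \<noteq> 0" "y = c *s x" "d \<noteq> 0" "z = d *s y" by blast
    then show "x \<noteq> 0 \<and> (\<exists>c. c \<noteq> 0 \<and> z = c *s x)"
      by (auto intro!: exI[of _ "d * c"])
  qed
qed

definition proj_pt :: "complex ^ 'n \<Rightarrow> 'n cproj" where
  "proj_pt x = abs_cproj x"

lemma proj_pt_eq_iff:
  assumes "x \<noteq> 0" "y \<noteq> 0"
  shows "proj_pt x = proj_pt y \<longleftrightarrow> (\<exists>c. c \<noteq> 0 \<and> y = c *s x)"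
  using assms Quotient3_rel[OF Quotient3_cproj, of x y]
  by (auto simp: proj_pt_def intro: exI[of _ 1])

lemma rep_cproj_nonzero: "rep_cproj p \<noteq> 0"
  using Quotient3_rep_reflp[OF Quotient3_cproj, of p] by simp

lemma proj_pt_rep: "proj_pt (rep_cproj p) = p"
  by (simp add: proj_pt_def Quotient3_abs_rep[OF Quotient3_cproj])

definition zariski_closed :: "'n::finite cproj set \<Rightarrow> bool" where
  "zariski_closed Z \<longleftrightarrow>
     (\<exists>S. (\<forall>P\<in>S. \<exists>d. form d P) \<and> Z = {proj_pt x | x. x \<noteq> 0 \<and> (\<forall>P\<in>S. P x = 0)})"

definition zariski_closure :: "'n::finite cproj set \<Rightarrow> 'n cproj set" where
  "zariski_closure A = \<Inter>{Z. zariski_closed Z \<and> A \<subseteq> Z}"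

definition for_general :: "('n::finite cproj \<Rightarrow> bool) \<Rightarrow> bool" where
  "for_general P \<longleftrightarrow> (\<exists>U. zariski_closed (- U) \<and> U \<noteq> {} \<and> (\<forall>p\<in>U. P p))"


section \<open>Rational maps and Cremona transformations\<close>

text \<open>A rational map between projective spaces is represented by the partial function defined
  on its full domain of definition. For a lift \<open>F\<close> without common factor, that domain is
  the set of points at which \<open>F\<close> does not vanish, so that two rational maps agree if and only
  if the partial functions are equal.\<close>

definition rational_map_of :: "(complex ^ 'n::finite \<Rightarrow> complex ^ 'm::finite) \<Rightarrow> 'n cproj \<rightharpoonup> 'm cproj" where
  "rational_map_of F p =
     (if F (rep_cproj p) = 0 then None else Some (proj_pt (F (rep_cproj p))))"

definition is_lift ::
  "nat \<Rightarrow> (complex ^ 'n::finite \<Rightarrow> complex ^ 'm::finite) \<Rightarrow> ('n cproj \<rightharpoonup> 'm cproj) \<Rightarrow> bool" where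
  "is_lift d F f \<longleftrightarrow>
     (\<forall>i. form d (\<lambda>x. F x $ i)) \<and> no_common_factor F \<and> f = rational_map_of F"

lemma rational_map_of_proj_pt:
  assumes "\<forall>i. form d (\<lambda>x. F x $ i)" and "x \<noteq> 0"
  shows "rational_map_of F (proj_pt x) = (if F x = 0 then None else Some (proj_pt (F x)))"
proof -
  obtain c where c: "c \<noteq> 0" "rep_cproj (proj_pt x) = c *s x"
    using proj_pt_eq_iff[of x "rep_cproj (proj_pt x)"] assms(2)
    by (metis proj_pt_rep rep_cproj_nonzero)
  have F: "F (c *s x) = (c ^ d) *s F x"
    using assms(1) by (simp add: form_def vec_eq_iff)
  show ?thesis
  proof (cases "F x = 0")
    case True
    then show ?thesis using c F by (simp add: rational_map_of_def)
  next
    case False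
    then have "proj_pt (F x) = proj_pt (c ^ d *s F x)"
      using c(1) by (subst proj_pt_eq_iff) auto
    then show ?thesis using c F False by (simp add: rational_map_of_def)
  qed
qed

definition birational_inverse ::
  "('n::finite cproj \<rightharpoonup> 'm::finite cproj) \<Rightarrow> ('m cproj \<rightharpoonup> 'n cproj) \<Rightarrow> bool" where
  "birational_inverse f g \<longleftrightarrow>
     for_general (\<lambda>p. (g \<circ>\<^sub>m f) p = Some p) \<and> for_general (\<lambda>q. (f \<circ>\<^sub>m g) q = Some q)"

text \<open>Cremona transformations of bidegree \<open>(d, e)\<close>.\<close>

definition Bir :: "nat \<Rightarrow> nat \<Rightarrow> ('n::finite cproj \<rightharpoonup> 'n cproj) set" where
  "Bir d e = {f. (\<exists>F. is_lift d F f) \<and> (\<exists>g G. is_lift e G g \<and> birational_inverse f g)}"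


section \<open>Secants and harmonic conjugates\<close>

definition proj_line :: "'n::finite cproj \<Rightarrow> 'n cproj \<Rightarrow> 'n cproj set" where
  "proj_line a b =
     {proj_pt w | u v w. u \<noteq> 0 \<and> v \<noteq> 0 \<and> a = proj_pt u \<and> b = proj_pt v
        \<and> w \<noteq> 0 \<and> w \<in> vec.span {u, v}}"

definition bracket :: "complex \<times> complex \<Rightarrow> complex \<times> complex \<Rightarrow> complex" where
  "bracket z w = fst z * snd w - fst w * snd z"

text \<open>For four points on a line, with homogeneous coordinates \<open>za, zb, zc, zd\<close> with respect to a
  basis \<open>u, v\<close> of the corresponding plane; in an affine coordinate this is
  \<open>((a - c) (b - d)) / ((a - d) (b - c))\<close>.\<close>

definition cross_ratio ::
  "'n::finite cproj \<Rightarrow> 'n cproj \<Rightarrow> 'n cproj \<Rightarrow> 'n cproj \<Rightarrow> complex" where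
  "cross_ratio a b c d = (THE k. \<exists>u v za zb zc zd.
     u \<noteq> v \<and> vec.independent {u, v} \<and>
     za \<noteq> (0, 0) \<and> zb \<noteq> (0, 0) \<and> zc \<noteq> (0, 0) \<and> zd \<noteq> (0, 0) \<and>
     a = proj_pt (fst za *s u + snd za *s v) \<and>
     b = proj_pt (fst zb *s u + snd zb *s v) \<and>
     c = proj_pt (fst zc *s u + snd zc *s v) \<and>
     d = proj_pt (fst zd *s u + snd zd *s v) \<and>
     k = (bracket za zc * bracket zb zd) / (bracket za zd * bracket zb zc))"

definition harmonic_conjugate :: "'n::finite cproj \<Rightarrow> 'n cproj \<Rightarrow> 'n cproj \<Rightarrow> 'n cproj" where
  "harmonic_conjugate a b p = (THE q. q \<in> proj_line a b \<and> cross_ratio a b p q = -1)"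

text \<open>The unordered pairs of distinct points of \<open>X\<close> spanning a secant line through \<open>p\<close>.\<close>

definition secant_pairs :: "'n::finite cproj set \<Rightarrow> 'n cproj \<Rightarrow> 'n cproj set set" where
  "secant_pairs X p = {{a, b} | a b. a \<in> X \<and> b \<in> X \<and> a \<noteq> b \<and> p \<in> proj_line a b}"

text \<open>Defined at \<open>p\<close> if and only if there is exactly one such pair. The choice of an ordering of
  this pair is immaterial, because exchanging \<open>a\<close> and \<open>b\<close> inverts the cross-ratio.\<close>

definition secant_harmonic_map :: "'n::finite cproj set \<Rightarrow> 'n cproj \<rightharpoonup> 'n cproj" where
  "secant_harmonic_map X p =
     (if \<exists>!s. s \<in> secant_pairs X p
      then Some (THE q. \<exists>a b. {a, b} \<in> secant_pairs X p \<and> q = harmonic_conjugate a b p)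
      else None)"


section \<open>The variety attached to a quadro-quadric Cremona transformation\<close>

text \<open>The index type of the \<open>2n + 2\<close> homogeneous coordinates \<open>[r : x : y : s]\<close>.\<close>

type_synonym 'n ambient = "unit + 'n + 'n + unit"

definition X_param ::
  "(complex ^ 'n::finite \<Rightarrow> complex ^ 'n) \<Rightarrow> (complex ^ 'n \<Rightarrow> complex) \<Rightarrow> complex ^ 'n
     \<Rightarrow> complex ^ 'n ambient" where
  "X_param F N x =
     (\<chi> k. case k of
        Inl _ \<Rightarrow> 1
      | Inr (Inl i) \<Rightarrow> x $ i
      | Inr (Inr (Inl i)) \<Rightarrow> F x $ i
      | Inr (Inr (Inr _)) \<Rightarrow> N x)"

definition X_variety ::
  "(complex ^ 'n::finite \<Rightarrow> complex ^ 'n) \<Rightarrow> (complex ^ 'n \<Rightarrow> complex) \<Rightarrow> 'n ambient cproj set" where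
  "X_variety F N = zariski_closure (range (\<lambda>x. proj_pt (X_param F N x)))"

end

theory Submission
  imports Defs "HOL-Computational_Algebra.Fundamental_Theorem_Algebra"
begin

text \<open>Write \<open>F(x, u)\<close> for the polarization of \<open>F\<close>. Comparing the terms linear in \<open>u\<close> of
  \<open>G (F (x + u)) = N (x + u) (x + u)\<close> and substituting \<open>x = G y\<close>, where \<open>F (G y) = M(y) y\<close>, shows that
  \<open>M(y)\<close> divides \<open>dN\<^bsub>G y\<^esub>(u) G\<^sub>i(y)\<close> for all \<open>i\<close>. As the \<open>G\<^sub>i\<close> have no common factor, it follows that
  \<open>dN\<^sub>x(u) = t(F x, u)\<close> with a bilinear form \<open>t\<close>, and \<open>t\<close> plays the same role for \<open>M\<close>. These identities
  are all that is needed of Jordan theory. They give a homogeneous cubic map \<open>\<Phi>\<close>, modelled on the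
  gradient of the quartic form of a Freudenthal triple system, such that
  \<open>\<Phi> (a X(u) + b X(v)) = a b N(u - v) (a X(u) - b X(v))\<close>, where \<open>X\<close> parametrizes the affine part of
  the cone over \<open>X\<^sub>f\<close>. So \<open>\<Phi>\<close> takes a point of a secant to its harmonic conjugate, and \<open>\<Phi> (\<Phi> p)\<close> is
  a multiple of \<open>p\<close>. A general point is \<open>a X(u) + b X(v)\<close> in exactly one way up to order: \<open>a\<close>, \<open>b\<close>, \<open>u\<close> and
  \<open>v\<close> are given by explicit formulas in the coordinates of the point and one square root.\<close>

section \<open>Polynomial functions and forms\<close>

lemma poly_fun_uminus: "poly_fun P \<Longrightarrow> poly_fun (\<lambda>x. - P x)"
  using poly_fun.mult[OF poly_fun.const[of "-1"], of P] by simp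

lemma poly_fun_diff: "poly_fun P \<Longrightarrow> poly_fun Q \<Longrightarrow> poly_fun (\<lambda>x. P x - Q x)"
  using poly_fun.add[OF _ poly_fun_uminus, of P Q] by simp

lemma poly_fun_power: "poly_fun P \<Longrightarrow> poly_fun (\<lambda>x. P x ^ k)"
  by (induction k) (auto intro: poly_fun.intros)

lemma poly_fun_sum: "(\<And>i. i \<in> I \<Longrightarrow> poly_fun (P i)) \<Longrightarrow> poly_fun (\<lambda>x. \<Sum>i\<in>I. P i x)"
  by (induction I rule: infinite_finite_induct) (auto intro: poly_fun.intros)

lemma poly_fun_divide: "poly_fun P \<Longrightarrow> poly_fun (\<lambda>x. P x / c)"
  using poly_fun.mult[OF poly_fun.const[of "inverse c"], of P] by (simp add: field_simps)

lemmas poly_fun_intros =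
  poly_fun.intros poly_fun_uminus poly_fun_diff poly_fun_power poly_fun_sum poly_fun_divide

lemma poly_fun_compose:
  assumes "poly_fun P" and "\<And>i. poly_fun (\<lambda>x. \<phi> x $ i)"
  shows "poly_fun (\<lambda>x. P (\<phi> x))"
  using assms(1) by induction (auto intro: poly_fun.intros assms(2))

text \<open>Restriction to lines transfers facts about \<open>complex poly\<close> (integral domain,
  roots, degrees) to polynomial functions of several variables.\<close>

lemma poly_fun_line:
  assumes "poly_fun P"
  obtains p where "\<And>c. P (x + c *s v) = poly p c"
proof -
  have "\<exists>p. \<forall>c. P (x + c *s v) = poly p c"
    using assms
  proof induction
    case (const c)
    then show ?case by (intro exI[of _ "[:c:]"]) simp
  next
    case (coord i)
    then show ?case by (intro exI[of _ "[:x $ i, v $ i:]"]) simp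
  next
    case (add P Q)
    then obtain p q where "\<forall>c. P (x + c *s v) = poly p c" "\<forall>c. Q (x + c *s v) = poly q c" by blast
    then show ?case by (intro exI[of _ "p + q"]) simp
  next
    case (mult P Q)
    then obtain p q where "\<forall>c. P (x + c *s v) = poly p c" "\<forall>c. Q (x + c *s v) = poly q c" by blast
    then show ?case by (intro exI[of _ "p * q"]) simp
  qed
  then show thesis using that by blast
qed

text \<open>On the line joining \<open>x\<close> and \<open>y\<close> both restrictions are nonzero
  univariate polynomials, hence so is their product.\<close>

lemma poly_fun_no_zero_divisors:
  assumes "poly_fun P" "poly_fun Q" "P x \<noteq> 0" "Q y \<noteq> 0"
  shows "\<exists>z. P z \<noteq> 0 \<and> Q z \<noteq> 0"
proof -
  obtain p where p: "\<And>c. P (x + c *s (y - x)) = poly p c" using poly_fun_line[OF assms(1)] by blast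
  obtain q where q: "\<And>c. Q (x + c *s (y - x)) = poly q c" using poly_fun_line[OF assms(2)] by blast
  have "p \<noteq> 0" "q \<noteq> 0" using p[of 0] q[of 1] assms by auto
  then have "p * q \<noteq> 0" by simp
  then obtain c where "poly (p * q) c \<noteq> 0" using poly_all_0_iff_0 by blast
  then show ?thesis using p[of c] q[of c] by (intro exI[of _ "x + c *s (y - x)"]) auto
qed

text \<open>Otherwise \<open>A - B\<close> and \<open>P\<close> would be nonzero at a common point.
  In this way identities obtained by a division at generic points extend to all points.\<close>

lemma poly_fun_eq_on_dense:
  assumes "poly_fun A" "poly_fun B" "poly_fun P" "P x\<^sub>0 \<noteq> 0" and "\<And>x. P x \<noteq> 0 \<Longrightarrow> A x = B x"
  shows "A x = B x"
proof (rule ccontr)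
  assume "A x \<noteq> B x"
  then obtain z where "P z \<noteq> 0" "A z - B z \<noteq> 0"
    using poly_fun_no_zero_divisors[OF assms(3) poly_fun_diff[OF assms(1,2)] assms(4), of x] by auto
  then show False using assms(5) by auto
qed

lemma poly_fun_mult_left_cancel:
  assumes "poly_fun A" "poly_fun B" "poly_fun P" "P x\<^sub>0 \<noteq> 0" and "\<And>x. P x * A x = P x * B x"
  shows "A x = B x"
proof (rule poly_fun_eq_on_dense[OF assms(1-4)])
  show "A x = B x" if "P x \<noteq> 0" for x using assms(5)[of x] that by simp
qed

text \<open>A nonconstant complex polynomial in one variable has a root.\<close>

lemma poly_fun_nonvanishing_line:
  assumes "poly_fun P" "\<And>c. P (x + c *s v) \<noteq> 0"
  shows "P (x + c *s v) = P x"
proof -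
  obtain p where p: "\<And>c. P (x + c *s v) = poly p c" using poly_fun_line[OF assms(1)] by blast
  have "constant (poly p)" using assms(2) p fundamental_theorem_of_algebra by metis
  then have "poly p c = poly p 0" unfolding constant_def by blast
  then show ?thesis using p[of c] p[of 0] by simp
qed

section \<open>Homogeneous forms and their restrictions to lines\<close>

lemma form_poly_fun: "form d P \<Longrightarrow> poly_fun P"
  by (simp add: form_def)

lemma form_scale: "form d P \<Longrightarrow> P (c *s x) = c ^ d * P x"
  by (simp add: form_def)

lemma form_diff: "form d P \<Longrightarrow> form d Q \<Longrightarrow> form d (\<lambda>x. P x - Q x)"
  by (auto simp: form_def algebra_simps intro: poly_fun_intros)

lemma form_mult: "form d P \<Longrightarrow> form e Q \<Longrightarrow> form (d + e) (\<lambda>x. P x * Q x)"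
  by (auto simp: form_def power_add intro: poly_fun_intros)

lemma form_cmult: "form d P \<Longrightarrow> form d (\<lambda>x. c * P x)"
  by (auto simp: form_def intro: poly_fun_intros)

lemma form_power: "form d P \<Longrightarrow> form (d * k) (\<lambda>x. P x ^ k)"
  by (auto simp: form_def power_mult power_mult_distrib intro: poly_fun_intros)

lemma form_coord: "form 1 (\<lambda>x. x $ i)"
  by (auto simp: form_def intro: poly_fun_intros)

lemma form_compose:
  assumes "form d P" and "\<And>i. form e (\<lambda>x. \<phi> x $ i)"
  shows "form (e * d) (\<lambda>x. P (\<phi> x))"
proof -
  have "\<phi> (c *s x) = c ^ e *s \<phi> x" for c x
    using assms(2) by (simp add: form_def vec_eq_iff)
  then show ?thesis
    using assms poly_fun_compose[of P \<phi>] by (auto simp: form_def power_mult)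
qed

lemma poly_eq_off_zero:
  fixes p q :: "complex poly"
  assumes "\<And>c. c \<noteq> 0 \<Longrightarrow> poly p c = poly q c"
  shows "p = q"
proof -
  have "poly ([:0, 1:] * (p - q)) c = 0" for c
    using assms[of c] by (cases "c = 0") auto
  then have "[:0, 1:] * (p - q) = 0" using poly_all_0_iff_0 by blast
  then show ?thesis by simp
qed

lemma form_right_factor:
  assumes "form d P" "form (d + e) Q" "poly_fun R" "P x\<^sub>0 \<noteq> 0" and QPR: "\<And>x. Q x = P x * R x"
  shows "form e R"
proof -
  have nz: "R (c *s x) = c ^ e * R x" if "c \<noteq> 0" for c x
  proof (rule poly_fun_mult_left_cancel[OF _ _ form_poly_fun[OF assms(1)] assms(4)])
    show "P x * R (c *s x) = P x * (c ^ e * R x)" for x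
    proof -
      have "c ^ d * (P x * R (c *s x)) = Q (c *s x)"
        using form_scale[OF assms(1), of c x] by (simp add: QPR)
      also have "\<dots> = c ^ d * (P x * (c ^ e * R x))"
        using form_scale[OF assms(2), of c x] by (simp add: QPR power_add algebra_simps)
      finally show ?thesis using that by (metis mult_left_cancel power_not_zero)
    qed
    show "poly_fun (\<lambda>x. R (c *s x))"
      by (rule poly_fun_compose[OF assms(3)]) (auto intro: poly_fun_intros)
  qed (auto intro: poly_fun_intros assms)
  \<comment> \<open>The cancellation above divides by \<open>c ^ d\<close>. The case
    \<open>c = 0\<close> follows because both sides are polynomials in \<open>c\<close> along the
    ray through \<open>x\<close>.\<close>
  have "R (c *s x) = c ^ e * R x" for c x
  proof -
    obtain p where p: "\<And>c. R (0 + c *s x) = poly p c" using poly_fun_line[OF assms(3)] by blast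
    have "p = monom (R x) e"
    proof (rule poly_eq_off_zero)
      show "poly p c = poly (monom (R x) e) c" if "c \<noteq> 0" for c
        unfolding p[symmetric] using nz[OF that, of x] by (simp add: poly_monom)
    qed
    then show ?thesis using p[of c] by (simp add: poly_monom)
  qed
  then show ?thesis using assms(3) by (simp add: form_def)
qed

text \<open>Let \<open>p\<close> and \<open>q\<close> be the restrictions to
  \<open>x + c *s v\<close> and \<open>v + c *s x\<close>. Homogeneity gives
  \<open>p(c) = c ^ d * q(1 / c)\<close>, so \<open>p\<close> is a reversal of \<open>q\<close>.
  This bounds its degree by \<open>d\<close> and identifies its top coefficient.\<close>

lemma form_line:
  assumes "form d P"
  obtains a where "a 0 = P x" "a d = P v" "\<And>c. P (x + c *s v) = (\<Sum>i\<le>d. a i * c ^ i)"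
proof -
  have P: "poly_fun P" using assms by (rule form_poly_fun)
  obtain p where p: "\<And>c. P (x + c *s v) = poly p c" using poly_fun_line[OF P] by blast
  obtain q where q: "\<And>c. P (v + c *s x) = poly q c" using poly_fun_line[OF P] by blast
  let ?m = "degree q"
  \<comment> \<open>\<open>reflect_poly q\<close> reverses with respect to the actual degree
    \<open>?m\<close> of \<open>q\<close>, which may differ from \<open>d\<close>; the two monomials
    compensate without negative exponents.\<close>
  let ?l = "monom 1 ?m * p" and ?r = "monom 1 d * reflect_poly q"
  have "poly ?l c = poly ?r c" if "c \<noteq> 0" for c
  proof -
    have "x + c *s v = c *s (v + inverse c *s x)"
      using that by (simp add: vec_eq_iff field_simps)
    then have "poly p c = c ^ d * poly q (inverse c)"
      unfolding p[symmetric] q[symmetric] by (simp only: form_scale[OF assms])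
    then show ?thesis
      using that by (simp add: poly_monom poly_reflect_poly_nz)
  qed
  then have lr: "?l = ?r" by (rule poly_eq_off_zero)
  have "degree p \<le> d"
  proof (cases "p = 0")
    case False
    then have "?l \<noteq> 0" by simp
    then have "reflect_poly q \<noteq> 0" using lr by (metis mult_zero_right)
    have "?m + degree p = degree ?l" using False by (simp add: degree_mult_eq degree_monom_eq)
    also have "\<dots> = d + degree (reflect_poly q)"
      unfolding lr using \<open>reflect_poly q \<noteq> 0\<close> by (subst degree_mult_eq) (auto simp: degree_monom_eq)
    also have "\<dots> \<le> d + ?m" using degree_reflect_poly_le by simp
    finally show ?thesis by simp
  qed simp
  moreover have "coeff p 0 = P x" using p[of 0] by (simp add: poly_0_coeff_0)
  moreover have "coeff p d = P v"
  proof -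
    have "coeff ?l (?m + d) = coeff ?r (?m + d)" using lr by simp
    then have "coeff p d = coeff (reflect_poly q) ?m"
      by (simp add: coeff_monom_mult)
    also have "\<dots> = coeff q 0" by (simp add: coeff_reflect_poly)
    also have "\<dots> = P v" using q[of 0] by (simp add: poly_0_coeff_0)
    finally show ?thesis .
  qed
  moreover have "P (x + c *s v) = (\<Sum>i\<le>d. coeff p i * c ^ i)" for c
    using \<open>degree p \<le> d\<close> unfolding p poly_altdef
    by (intro sum.mono_neutral_left) (auto simp: coeff_eq_0)
  ultimately show thesis using that[of "coeff p"] by blast
qed

lemma form_1_add_scale:
  assumes "form 1 P"
  shows "P (x + c *s v) = P x + c * P v"
proof -
  obtain a where a: "a 0 = P x" "a 1 = P v" "\<And>c. P (x + c *s v) = (\<Sum>i\<le>1. a i * c ^ i)"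
    using form_line[OF assms] by blast
  then show ?thesis by simp
qed

section \<open>Polarization of quadratic and cubic forms\<close>

definition polar :: "('a::ab_group_add \<Rightarrow> 'b::ab_group_add) \<Rightarrow> 'a \<Rightarrow> 'a \<Rightarrow> 'b" where
  "polar P x u = P (x + u) - P x - P u"

text \<open>For a cubic form this is the differential at \<open>x\<close> in direction
  \<open>u\<close>, the coefficient of \<open>c\<close> in \<open>P (x + c *s u)\<close>: the part
  of \<open>P (x + u)\<close> that is odd in \<open>u\<close> also contains \<open>P u\<close>,
  which is subtracted.\<close>

definition cubic_deriv :: "('a::ab_group_add \<Rightarrow> complex) \<Rightarrow> 'a \<Rightarrow> 'a \<Rightarrow> complex" where
  "cubic_deriv P x u = (P (x + u) - P (x - u)) / 2 - P u"

lemma polar_commute: "polar P x u = polar P u x"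
  by (simp add: polar_def add.commute)

lemma form_2_add_scale:
  assumes "form 2 P"
  shows "P (x + c *s v) = P x + c * polar P x v + c\<^sup>2 * P v"
proof -
  obtain a where a: "a 0 = P x" "a 2 = P v" "\<And>c. P (x + c *s v) = (\<Sum>i\<le>2. a i * c ^ i)"
    using form_line[OF assms] by blast
  have q: "P (x + c *s v) = P x + c * a 1 + c\<^sup>2 * P v" for c
    using a by (simp add: eval_nat_numeral)
  have "polar P x v = a 1" using q[of 1] by (simp add: polar_def)
  then show ?thesis using q by simp
qed

lemma form_3_add_scale:
  assumes "form 3 P"
  shows "P (x + c *s v) = P x + c * cubic_deriv P x v + c\<^sup>2 * cubic_deriv P v x + c ^ 3 * P v"
proof -
  obtain a where a: "a 0 = P x" "a 3 = P v" "\<And>c. P (x + c *s v) = (\<Sum>i\<le>3. a i * c ^ i)"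
    using form_line[OF assms] by blast
  have q: "P (x + c *s v) = P x + c * a 1 + c\<^sup>2 * a 2 + c ^ 3 * P v" for c
    using a by (simp add: eval_nat_numeral)
  \<comment> \<open>The values at \<open>c = 1\<close> and \<open>c = -1\<close> separate the two
    middle coefficients; oddness of \<open>P\<close> lets the second one be read as a differential
    at \<open>v\<close>.\<close>
  have "P (v - x) = - P (x - v)"
    using form_scale[OF assms, of "-1" "x - v"] by (simp add: vector_smult_lneg)
  moreover have "P (x - v) = P x - a 1 + a 2 - P v"
    using q[of "-1"] by (simp add: vector_smult_lneg)
  moreover have "P (x + v) = P x + a 1 + a 2 + P v"
    using q[of 1] by simp
  ultimately have "cubic_deriv P x v = a 1" "cubic_deriv P v x = a 2"
    by (simp_all add: cubic_deriv_def add.commute[of v x] add_divide_distrib)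
  then show ?thesis using q by simp
qed

lemma form_1_polar:
  assumes "form 2 P"
  shows "form 1 (polar P x)"
proof -
  have "poly_fun (polar P x)"
    unfolding polar_def
    by (intro poly_fun_intros poly_fun_compose[OF form_poly_fun[OF assms]]) (auto intro!: poly_fun_intros)
  moreover have "polar P x (c *s v) = c * polar P x v" for c v
    using form_2_add_scale[OF assms, of x c v] form_scale[OF assms, of c v] by (simp add: polar_def)
  ultimately show ?thesis by (simp add: form_def)
qed

lemma form_1_cubic_deriv:
  assumes "form 3 P"
  shows "form 1 (cubic_deriv P x)"
proof -
  have "poly_fun (cubic_deriv P x)"
    unfolding cubic_deriv_def
    by (intro poly_fun_intros poly_fun_compose[OF form_poly_fun[OF assms]]) (auto intro!: poly_fun_intros)
  moreover have "cubic_deriv P x (c *s v) = c * cubic_deriv P x v" for c v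
    using form_3_add_scale[OF assms, of x c v] form_3_add_scale[OF assms, of x "-c" v] form_scale[OF assms, of c v]
    by (simp add: cubic_deriv_def[of _ _ "c *s v"] vector_smult_lneg field_simps)
  ultimately show ?thesis by (simp add: form_def)
qed

lemma form_cubic_deriv_left:
  assumes "form 3 P"
  shows "form 2 (\<lambda>x. cubic_deriv P x v)"
proof -
  have "poly_fun (\<lambda>x. cubic_deriv P x v)"
    unfolding cubic_deriv_def
    by (intro poly_fun_intros poly_fun_compose[OF form_poly_fun[OF assms]]) (auto intro!: poly_fun_intros)
  \<comment> \<open>\<open>P (v + c *s x)\<close> is expanded at \<open>v\<close> both in the
    direction \<open>c *s x\<close> and in the direction \<open>x\<close>, and the terms are
    compared.\<close>
  moreover have "cubic_deriv P (c *s x) v = c\<^sup>2 * cubic_deriv P x v" for c x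
    using form_3_add_scale[OF assms, of v 1 "c *s x"] form_3_add_scale[OF assms, of v c x]
      form_scale[OF assms, of c x] form_1_cubic_deriv[OF assms, of v]
    by (simp add: form_def)
  ultimately show ?thesis by (simp add: form_def)
qed

section \<open>Divisibility by linear and quadratic forms\<close>

definition poly_dvd :: "(complex ^ 'n \<Rightarrow> complex) \<Rightarrow> (complex ^ 'n \<Rightarrow> complex) \<Rightarrow> bool" where
  "poly_dvd P A \<longleftrightarrow> (\<exists>R. poly_fun R \<and> (\<forall>x. A x = P x * R x))"

text \<open>Nonzero constants satisfy this too; where a contradiction with primitivity is derived,
  non-constancy is supplied by \<open>nonzero_form_not_const\<close>.\<close>

definition prime_poly_fun :: "(complex ^ 'n \<Rightarrow> complex) \<Rightarrow> bool" where
  "prime_poly_fun P \<longleftrightarrow> poly_fun P \<and>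
     (\<forall>A B. poly_fun A \<and> poly_fun B \<and> poly_dvd P (\<lambda>x. A x * B x) \<longrightarrow> poly_dvd P A \<or> poly_dvd P B)"

text \<open>Induction on the construction of \<open>A\<close>, with a discrete Leibniz rule for
  products.\<close>

lemma poly_fun_translate_dvd:
  assumes "poly_fun A" "poly_fun s"
  shows "\<exists>R. poly_fun R \<and> (\<forall>x. A x - A (x - s x *s e) = s x * R x)"
  using assms(1)
proof induction
  case (const c)
  show ?case by (intro exI[of _ "\<lambda>x. 0"]) (auto intro: poly_fun_intros)
next
  case (coord i)
  show ?case by (intro exI[of _ "\<lambda>x. e $ i"]) (auto intro: poly_fun_intros)
next
  case (add P Q)
  then obtain R S where "poly_fun R" "poly_fun S" "\<And>x. P x - P (x - s x *s e) = s x * R x"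
    "\<And>x. Q x - Q (x - s x *s e) = s x * S x" by blast
  then show ?case
    by (intro exI[of _ "\<lambda>x. R x + S x"]) (auto intro: poly_fun_intros simp: ring_distribs add_diff_add)
next
  case (mult P Q)
  then obtain R S where RS: "poly_fun R" "poly_fun S" "\<And>x. P x - P (x - s x *s e) = s x * R x"
    "\<And>x. Q x - Q (x - s x *s e) = s x * S x" by blast
  have "poly_fun (\<lambda>x. Q (x - s x *s e))"
    by (rule poly_fun_compose[OF mult.hyps(2)]) (auto intro!: poly_fun_intros assms(2))
  moreover have "P x * Q x - P (x - s x *s e) * Q (x - s x *s e)
      = s x * (P x * S x + R x * Q (x - s x *s e))" for x
  proof -
    have "P x * Q x - P (x - s x *s e) * Q (x - s x *s e)
      = P x * (Q x - Q (x - s x *s e)) + (P x - P (x - s x *s e)) * Q (x - s x *s e)"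
      by (simp add: algebra_simps)
    then show ?thesis unfolding RS(3,4) by (simp add: algebra_simps)
  qed
  ultimately show ?case using RS(1,2) mult.hyps
    by (intro exI[of _ "\<lambda>x. P x * S x + R x * Q (x - s x *s e)"]) (auto intro: poly_fun_intros)
qed

text \<open>The Nullstellensatz for a hyperplane: \<open>A x\<close> is compared with the value of
  \<open>A\<close> at the projection of \<open>x\<close> along \<open>e\<close> onto
  \<open>l = 0\<close>.\<close>

lemma linear_dvd_iff:
  assumes "form 1 l" "l e \<noteq> 0" "poly_fun A"
  shows "poly_dvd l A \<longleftrightarrow> (\<forall>x. l x = 0 \<longrightarrow> A x = 0)"
proof
  show "poly_dvd l A \<Longrightarrow> \<forall>x. l x = 0 \<longrightarrow> A x = 0" by (auto simp: poly_dvd_def)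
next
  assume *: "\<forall>x. l x = 0 \<longrightarrow> A x = 0"
  let ?s = "\<lambda>x. l x / l e"
  obtain R where R: "poly_fun R" "\<And>x. A x - A (x - ?s x *s e) = ?s x * R x"
    using poly_fun_translate_dvd[OF assms(3) poly_fun_divide[OF form_poly_fun[OF assms(1)]]] by blast
  have "l (x - ?s x *s e) = 0" for x
    using form_1_add_scale[OF assms(1), of x "- ?s x" e] assms(2) by (simp add: vector_smult_lneg)
  then have "A x = l x * (R x / l e)" for x
    using R(2)[of x] * by simp
  then show "poly_dvd l A" unfolding poly_dvd_def using poly_fun_divide[OF R(1)] by blast
qed

text \<open>Composition with the projection \<open>\<pi>\<close> onto the hyperplane gives
  polynomial functions again, and those have no zero divisors.\<close>

lemma prime_linear:
  assumes "form 1 l" "l e \<noteq> 0"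
  shows "prime_poly_fun l"
  unfolding prime_poly_fun_def
proof (intro conjI allI impI)
  show l: "poly_fun l" using assms(1) by (rule form_poly_fun)
  fix A B :: "complex ^ 'a \<Rightarrow> complex"
  assume AB: "poly_fun A \<and> poly_fun B \<and> poly_dvd l (\<lambda>x. A x * B x)"
  define \<pi> where "\<pi> x = x - (l x / l e) *s e" for x
  have l\<pi>: "l (\<pi> x) = 0" for x
    using form_1_add_scale[OF assms(1), of x "- (l x / l e)" e] assms(2)
    by (simp add: \<pi>_def vector_smult_lneg)
  have comp: "poly_fun (\<lambda>x. P (\<pi> x))" if "poly_fun P" for P
    by (rule poly_fun_compose[OF that]) (auto simp: \<pi>_def intro!: poly_fun_intros l)
  show "poly_dvd l A \<or> poly_dvd l B"
  proof (rule ccontr)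
    assume "\<not> (poly_dvd l A \<or> poly_dvd l B)"
    then obtain x y where "l x = 0" "A x \<noteq> 0" "l y = 0" "B y \<noteq> 0"
      using linear_dvd_iff[OF assms] AB by blast
    moreover have "A (\<pi> x) * B (\<pi> x) = 0" for x
      using AB l\<pi>[of x] unfolding poly_dvd_def by (metis mult_zero_left)
    ultimately show False
      using poly_fun_no_zero_divisors[OF comp comp, of A B x y] AB by (auto simp: \<pi>_def)
  qed
qed

text \<open>As \<open>l\<close> is prime and does not divide \<open>Q\<close>, each of the
  \<open>k\<close> factors \<open>l\<close> can be cancelled from the cofactor
  \<open>C\<close>.\<close>

lemma prime_linear_power_cancel:
  assumes l: "form 1 l" "l e \<noteq> 0" and Q: "poly_fun Q" "\<not> poly_dvd l Q" and A: "poly_fun A"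
    and "poly_fun C" "\<And>x. l x ^ k * A x = Q x * C x"
  shows "poly_dvd Q A"
  using assms(6,7)
proof (induction k arbitrary: C)
  case 0
  then show ?case by (auto simp: poly_dvd_def)
next
  case (Suc k)
  have "poly_dvd l (\<lambda>x. Q x * C x)"
    unfolding poly_dvd_def using Suc.prems(2) A l
    by (intro exI[of _ "\<lambda>x. l x ^ k * A x"]) (auto intro!: poly_fun_intros form_poly_fun[OF l(1)] simp: mult.assoc)
  then have "poly_dvd l C"
    using prime_linear[OF l] Q Suc.prems(1) by (auto simp: prime_poly_fun_def)
  then obtain D where D: "poly_fun D" "\<And>x. C x = l x * D x" by (auto simp: poly_dvd_def)
  have "l x ^ k * A x = Q x * D x" for x
  proof (rule poly_fun_mult_left_cancel[OF _ _ form_poly_fun[OF l(1)] l(2)])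
    show "l x * (l x ^ k * A x) = l x * (Q x * D x)" for x
      using Suc.prems(2)[of x] D(2)[of x] by (simp add: mult.assoc mult.left_commute)
  qed (use A D Q form_poly_fun[OF l(1)] in \<open>auto intro: poly_fun_intros\<close>)
  then show ?case using Suc.IH D(1) by blast
qed

text \<open>Where \<open>l x \<noteq> 0\<close>, translating \<open>x\<close> by \<open>- (Q x / l x) *s e\<close> projects onto the zero set of \<open>Q\<close>;
  \<open>A'\<close> is the pullback of \<open>A\<close> along this projection with denominators cleared.\<close>

lemma quadric_projection:
  assumes "poly_fun A" "poly_fun Q" "poly_fun l"
  shows "\<exists>k A' C. poly_fun A' \<and> poly_fun C \<and> (\<forall>x. l x ^ k * A x = A' x + Q x * C x) \<and>
    (\<forall>x. l x \<noteq> 0 \<longrightarrow> A' x = l x ^ k * A (x - (Q x / l x) *s e))"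
  using assms(1)
proof induction
  case (const c)
  show ?case by (rule exI[of _ 0], rule exI[of _ "\<lambda>x. c"], rule exI[of _ "\<lambda>x. 0"])
    (auto intro: poly_fun_intros)
next
  case (coord i)
  show ?case by (rule exI[of _ 1], rule exI[of _ "\<lambda>x. l x * x $ i - Q x * e $ i"], rule exI[of _ "\<lambda>x. e $ i"])
    (auto intro!: poly_fun_intros assms simp: field_simps)
next
  case (add P R)
  then obtain k A' C j B' D where *: "poly_fun A'" "poly_fun C" "poly_fun B'" "poly_fun D"
    "\<And>x. l x ^ k * P x = A' x + Q x * C x" "\<And>x. l x ^ j * R x = B' x + Q x * D x"
    "\<And>x. l x \<noteq> 0 \<Longrightarrow> A' x = l x ^ k * P (x - (Q x / l x) *s e)"
    "\<And>x. l x \<noteq> 0 \<Longrightarrow> B' x = l x ^ j * R (x - (Q x / l x) *s e)" by blast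
  have "l x ^ (k + j) * (P x + R x) = (l x ^ j * A' x + l x ^ k * B' x) + Q x * (l x ^ j * C x + l x ^ k * D x)" for x
  proof -
    have "l x ^ (k + j) * (P x + R x) = l x ^ j * (l x ^ k * P x) + l x ^ k * (l x ^ j * R x)"
      by (simp add: power_add algebra_simps)
    then show ?thesis unfolding *(5,6) by (simp add: algebra_simps)
  qed
  then show ?case using *(1-4,7,8) assms(3)
    by (intro exI[of _ "k + j"] exI[of _ "\<lambda>x. l x ^ j * A' x + l x ^ k * B' x"] exI[of _ "\<lambda>x. l x ^ j * C x + l x ^ k * D x"])
      (auto intro!: poly_fun_intros simp: power_add algebra_simps)
next
  case (mult P R)
  then obtain k A' C j B' D where *: "poly_fun A'" "poly_fun C" "poly_fun B'" "poly_fun D"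
    "\<And>x. l x ^ k * P x = A' x + Q x * C x" "\<And>x. l x ^ j * R x = B' x + Q x * D x"
    "\<And>x. l x \<noteq> 0 \<Longrightarrow> A' x = l x ^ k * P (x - (Q x / l x) *s e)"
    "\<And>x. l x \<noteq> 0 \<Longrightarrow> B' x = l x ^ j * R (x - (Q x / l x) *s e)" by blast
  have "l x ^ (k + j) * (P x * R x) = A' x * B' x + Q x * (A' x * D x + C x * B' x + Q x * C x * D x)" for x
  proof -
    have "l x ^ (k + j) * (P x * R x) = (l x ^ k * P x) * (l x ^ j * R x)"
      by (simp add: power_add algebra_simps)
    then show ?thesis unfolding *(5,6) by (simp add: algebra_simps)
  qed
  then show ?case using *(1-4,7,8) assms(2)
    by (intro exI[of _ "k + j"] exI[of _ "\<lambda>x. A' x * B' x"]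
        exI[of _ "\<lambda>x. A' x * D x + C x * B' x + Q x * C x * D x"])
      (auto intro!: poly_fun_intros simp: power_add algebra_simps)
qed

section \<open>Quadratic forms: prime or a product of linear forms\<close>

lemma prime_quadric:
  assumes Q: "form 2 Q" "Q e = 0" and l: "polar Q e w \<noteq> 0" "\<not> poly_dvd (polar Q e) Q"
  shows "prime_poly_fun Q"
  unfolding prime_poly_fun_def
proof (intro conjI allI impI)
  let ?l = "polar Q e"
  note l1 = form_1_polar[OF Q(1), of e]
  note pQ = form_poly_fun[OF Q(1)] and pl = form_poly_fun[OF l1]
  show "poly_fun Q" by (rule pQ)
  fix A B :: "complex ^ 'a \<Rightarrow> complex"
  assume AB: "poly_fun A \<and> poly_fun B \<and> poly_dvd Q (\<lambda>x. A x * B x)"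
  obtain k A' C where A': "poly_fun A'" "poly_fun C" "\<And>x. ?l x ^ k * A x = A' x + Q x * C x"
    "\<And>x. ?l x \<noteq> 0 \<Longrightarrow> A' x = ?l x ^ k * A (x - (Q x / ?l x) *s e)"
    using quadric_projection[OF _ pQ pl, of A] AB by blast
  obtain j B' D where B': "poly_fun B'" "poly_fun D" "\<And>x. ?l x ^ j * B x = B' x + Q x * D x"
    "\<And>x. ?l x \<noteq> 0 \<Longrightarrow> B' x = ?l x ^ j * B (x - (Q x / ?l x) *s e)"
    using quadric_projection[OF _ pQ pl, of B] AB by blast
  \<comment> \<open>As \<open>Q e = 0\<close>, \<open>Q\<close> is affine along \<open>e\<close>
    with slope \<open>?l x\<close>, so the translated point lies on the quadric, where
    \<open>A * B\<close> vanishes. The quadric is thus parametrized rationally, and one of the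
    pullbacks must vanish identically.\<close>
  have "A' x * B' x = 0" if "?l x \<noteq> 0" for x
  proof -
    have "Q (x - (Q x / ?l x) *s e) = 0"
      using form_2_add_scale[OF Q(1), of x "- (Q x / ?l x)" e] that Q(2)
      by (simp add: vector_smult_lneg polar_commute[of Q x e])
    then have "A (x - (Q x / ?l x) *s e) * B (x - (Q x / ?l x) *s e) = 0"
      using AB unfolding poly_dvd_def by (metis mult_zero_left)
    then show ?thesis using A'(4)[OF that] B'(4)[OF that] by auto
  qed
  then have "A' x * B' x = 0" for x
    using poly_fun_eq_on_dense[OF _ poly_fun.const pl l(1), of "\<lambda>x. A' x * B' x" 0 x] A'(1) B'(1)
    by (auto intro: poly_fun_intros)
  then have "(\<forall>x. A' x = 0) \<or> (\<forall>x. B' x = 0)"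
    using poly_fun_no_zero_divisors[OF A'(1) B'(1)] by fastforce
  then show "poly_dvd Q A \<or> poly_dvd Q B"
  proof
    assume "\<forall>x. A' x = 0"
    then have "poly_dvd Q A"
      using prime_linear_power_cancel[OF l1 l(1) pQ l(2), of A C k] A' AB by simp
    then show ?thesis ..
  next
    assume "\<forall>x. B' x = 0"
    then have "poly_dvd Q B"
      using prime_linear_power_cancel[OF l1 l(1) pQ l(2), of B D j] B' AB by simp
    then show ?thesis ..
  qed
qed

text \<open>On the line \<open>x + s *s a\<close> some point is isotropic. Since it is then in the
  radical, \<open>s\<close> is a double root, so the discriminant of the quadratic equation for
  \<open>s\<close> vanishes.\<close>

lemma square_if_isotropic_imp_radical:
  assumes Q: "form 2 Q" "Q a \<noteq> 0" and rad: "\<And>e x. Q e = 0 \<Longrightarrow> polar Q e x = 0"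
  shows "Q x = (polar Q a x)\<^sup>2 / (4 * Q a)"
proof -
  let ?b = "polar Q x a"
  define d where "d = csqrt (?b\<^sup>2 - 4 * Q a * Q x)"
  define s where "s = (d - ?b) / (2 * Q a)"
  have "d\<^sup>2 = ?b\<^sup>2 - 4 * Q a * Q x" by (simp add: d_def)
  moreover have "d = 2 * Q a * s + ?b" using Q(2) by (simp add: s_def)
  ultimately have "4 * Q a * (Q x + s * ?b + s\<^sup>2 * Q a) = 0"
    by (simp add: algebra_simps power2_eq_square)
  then have root: "Q x + s * ?b + s\<^sup>2 * Q a = 0" using Q(2) by simp
  then have e: "Q (x + s *s a) = 0"
    using form_2_add_scale[OF Q(1), of x s a] by simp
  have lin: "polar Q a (x + s *s a) = polar Q a x + s * polar Q a a"
    by (rule form_1_add_scale[OF form_1_polar[OF Q(1)]])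
  have "polar Q a a = 2 * Q a"
    using form_2_add_scale[OF Q(1), of a 1 a] form_2_add_scale[OF Q(1), of a "-1" a] form_scale[OF Q(1), of 0 a]
    by (simp add: vector_smult_lneg)
  then have b: "polar Q a x = - (2 * s * Q a)"
    using rad[OF e, of a] lin polar_commute[of Q "x + s *s a" a] by (simp add: add_eq_0_iff mult.assoc mult.commute[of s] mult.left_commute[of s] minus_equation_iff[of _ "polar Q a x"])
  then show ?thesis using root Q(2)
    by (simp add: polar_commute[of Q x a] field_simps power2_eq_square)
qed

text \<open>If all isotropic vectors lie in the radical, \<open>Q\<close> is a square. Otherwise
  take an isotropic \<open>e\<close> outside it: either \<open>polar Q e\<close> divides
  \<open>Q\<close>, with a linear cofactor by degree, or projection along \<open>e\<close> shows
  that \<open>Q\<close> is prime.\<close>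

lemma quadric_prime_or_split:
  assumes Q: "form 2 Q" "Q a \<noteq> 0"
  shows "prime_poly_fun Q \<or> (\<exists>l m. form 1 l \<and> form 1 m \<and> (\<forall>x. Q x = l x * m x))"
proof (cases "\<exists>e w. Q e = 0 \<and> polar Q e w \<noteq> 0")
  case False
  then have "Q x = polar Q a x * (1 / (4 * Q a) * polar Q a x)" for x
    using square_if_isotropic_imp_radical[OF Q, of x] by (simp add: power2_eq_square)
  then show ?thesis using form_1_polar[OF Q(1), of a] form_cmult by blast
next
  case True
  then obtain e w where e: "Q e = 0" "polar Q e w \<noteq> 0" by blast
  show ?thesis
  proof (cases "poly_dvd (polar Q e) Q")
    case False
    then show ?thesis using prime_quadric[OF Q(1) e] by blast
  next
    case True
    let ?l = "polar Q e"
    note l1 = form_1_polar[OF Q(1), of e]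
    obtain m where m: "poly_fun m" "\<And>x. Q x = ?l x * m x" using True by (auto simp: poly_dvd_def)
    have "form 1 m"
      by (rule form_right_factor[OF l1 _ m(1) e(2) m(2)]) (use Q(1) in \<open>simp add: numeral_2_eq_2\<close>)
    then show ?thesis using l1 m(2) by blast
  qed
qed

lemma nonzero_form_not_const:
  assumes "form d P" "d > 0" "P x \<noteq> 0"
  shows "\<not> (\<exists>c. \<forall>x. P x = c)"
proof
  assume "\<exists>c. \<forall>x. P x = c"
  then have "P x = P (0 *s x)" by metis
  also have "\<dots> = 0" by (simp only: form_scale[OF assms(1)]) (use assms(2) in simp)
  finally show False using assms(3) by simp
qed

text \<open>A replacement for unique factorization that suffices for quadratic tuples.\<close>

lemma proportional_to_primitive_quadratic:
  fixes G :: "complex ^ 'n \<Rightarrow> complex ^ 'm"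
  assumes G: "\<And>i. form 2 (\<lambda>x. G x $ i)" "no_common_factor G" "G x\<^sub>0 \<noteq> 0"
    and A: "\<And>i. poly_fun (A i)" "\<And>i j x. A i x * G x $ j = A j x * G x $ i"
  obtains H where "poly_fun H" "\<And>i x. A i x = H x * G x $ i"
proof -
  obtain i where i: "G x\<^sub>0 $ i \<noteq> 0" using G(3) by (auto simp: vec_eq_iff)
  have pG: "poly_fun (\<lambda>x. G x $ j)" for j by (rule form_poly_fun[OF G(1)])
  \<comment> \<open>A nonconstant prime that divides all \<open>C * G_j\<close> but not
    \<open>C\<close> would be a common factor of the \<open>G_j\<close>.\<close>
  have dvdI: "poly_dvd p C"
    if p: "prime_poly_fun p" "form d p" "d > 0" "p y \<noteq> 0" and C: "poly_fun C" "\<And>j. poly_dvd p (\<lambda>x. C x * G x $ j)"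
    for p d y C
  proof (rule ccontr)
    assume "\<not> poly_dvd p C"
    then have "poly_dvd p (\<lambda>x. G x $ j)" for j
      using p(1) C pG by (auto simp: prime_poly_fun_def)
    then obtain R where "\<And>j. poly_fun (R j)" "\<And>j x. G x $ j = p x * R j x"
      unfolding poly_dvd_def by metis
    then have "\<exists>c. \<forall>x. p x = c"
      using G(2) form_poly_fun[OF p(2)] unfolding no_common_factor_def by blast
    then show False using nonzero_form_not_const[OF p(2-4)] by blast
  qed
  have "poly_dvd (\<lambda>x. G x $ i) (A i)"
    using quadric_prime_or_split[OF G(1) i]
  proof
    assume "prime_poly_fun (\<lambda>x. G x $ i)"
    then show ?thesis
    proof (rule dvdI[OF _ G(1) _ i A(1)])
      show "poly_dvd (\<lambda>x. G x $ i) (\<lambda>x. A i x * G x $ j)" for j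
        unfolding poly_dvd_def using A by (metis mult.commute)
    qed simp
  next
    assume "\<exists>l m. form 1 l \<and> form 1 m \<and> (\<forall>x. G x $ i = l x * m x)"
    then obtain l m where lm: "form 1 l" "form 1 m" "\<And>x. G x $ i = l x * m x" by blast
    have nz: "l x\<^sub>0 \<noteq> 0" "m x\<^sub>0 \<noteq> 0" using i lm(3)[of x\<^sub>0] by auto
    note plm = form_poly_fun[OF lm(1)] form_poly_fun[OF lm(2)]
    have "poly_dvd l (A i)"
    proof (rule dvdI[OF prime_linear[OF lm(1) nz(1)] lm(1) _ nz(1) A(1)])
      show "poly_dvd l (\<lambda>x. A i x * G x $ j)" for j
        unfolding poly_dvd_def using A(2)[of i _ j] lm(3)
        by (intro exI[of _ "\<lambda>x. m x * A j x"])
          (auto intro: poly_fun_intros plm A(1) simp: algebra_simps)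
    qed simp
    then obtain C where C: "poly_fun C" "\<And>x. A i x = l x * C x" by (auto simp: poly_dvd_def)
    \<comment> \<open>Removing \<open>l\<close> before treating \<open>m\<close> also covers
      proportional factors \<open>l\<close> and \<open>m\<close>.\<close>
    have "C x * G x $ j = m x * A j x" for x j
    proof (rule poly_fun_mult_left_cancel[OF _ _ plm(1) nz(1)])
      show "l x * (C x * G x $ j) = l x * (m x * A j x)" for x
        using A(2)[of i x j] C(2)[of x] lm(3)[of x] by (simp add: algebra_simps)
    qed (auto intro: poly_fun_intros A C plm pG)
    then have "poly_dvd m (\<lambda>x. C x * G x $ j)" for j
      unfolding poly_dvd_def using A(1) by blast
    then have "poly_dvd m C"
      using dvdI[OF prime_linear[OF lm(2) nz(2)] lm(2) _ nz(2) C(1)] by simp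
    then show ?thesis using C(2) lm(3) unfolding poly_dvd_def by (metis mult.assoc)
  qed
  then obtain H where H: "poly_fun H" "\<And>x. A i x = G x $ i * H x" by (auto simp: poly_dvd_def)
  have "A j x = H x * G x $ j" for j x
  proof (rule poly_fun_mult_left_cancel[OF A(1) _ pG i])
    show "G x $ i * A j x = G x $ i * (H x * G x $ j)" for x
      using A(2)[of i x j] unfolding H(2) by (simp only: ac_simps)
  qed (auto intro: poly_fun_intros H pG)
  then show thesis using that H(1) by blast
qed

section \<open>Polarization of mutually inverse quadratic maps\<close>

lemma form_1_add: "form 1 L \<Longrightarrow> L (x + y) = L x + L y"
  using form_1_add_scale[of L x 1 y] by simp

lemma form_1_diff: "form 1 L \<Longrightarrow> L (x - y) = L x - L y"
  using form_1_add_scale[of L x "-1" y] by (simp add: vector_smult_lneg)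

lemma form_1_eq_sum:
  assumes "form 1 L"
  shows "L u = (\<Sum>j\<in>UNIV. u $ j * L (axis j 1))"
proof -
  have "L (\<Sum>j\<in>S. u $ j *s axis j 1) = (\<Sum>j\<in>S. u $ j * L (axis j 1))" if "finite S" for S
    using that
  proof induction
    case empty
    show ?case using form_scale[OF assms, of 0 0] by simp
  next
    case (insert j S)
    then show ?case using form_scale[OF assms] by (simp add: form_1_add[OF assms])
  qed
  from this[of UNIV] show ?thesis by (simp add: basis_expansion)
qed

text \<open>Degree 4 is that of \<open>G (F (x + c *s u))\<close> in \<open>c\<close>; the lemma
  extracts first-order terms of polynomial identities without analysis.\<close>

lemma linear_coeff_eq_0:
  fixes a :: "nat \<Rightarrow> complex"
  assumes "\<And>c. a 0 + c * a 1 + c\<^sup>2 * a 2 + c ^ 3 * a 3 + c ^ 4 * a 4 = 0"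
  shows "a 1 = 0"
proof -
  have "poly [:a 0, a 1, a 2, a 3, a 4:] c = 0" for c
    using assms[of c] by (simp add: algebra_simps eval_nat_numeral)
  then have "[:a 0, a 1, a 2, a 3, a 4:] = 0" using poly_all_0_iff_0 by blast
  then show ?thesis by simp
qed

section \<open>Calculus of quadratic maps and of mutually inverse pairs\<close>

locale quadratic_map =
  fixes F :: "complex ^ 'n::finite \<Rightarrow> complex ^ 'm::finite"
  assumes form_2: "form 2 (\<lambda>x. F x $ i)"
begin

lemma polar_component: "polar F x u $ i = polar (\<lambda>x. F x $ i) x u"
  by (simp add: polar_def)

lemma scale: "F (c *s x) = c\<^sup>2 *s F x"
  using form_scale[OF form_2] by (simp add: vec_eq_iff)

lemma zero: "F 0 = 0"
  using scale[of 0 0] by simp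

lemma add_scale: "F (x + c *s u) = F x + c *s polar F x u + c\<^sup>2 *s F u"
  using form_2_add_scale[OF form_2] by (simp add: vec_eq_iff polar_component)

lemma polar_form_1: "form 1 (\<lambda>u. polar F x u $ i)"
  unfolding polar_component by (rule form_1_polar[OF form_2])

lemma polar_add_right: "polar F x (u + v) = polar F x u + polar F x v"
  using form_1_add[OF polar_form_1] by (simp add: vec_eq_iff)

lemma polar_scale_right: "polar F x (c *s u) = c *s polar F x u"
  using form_scale[OF polar_form_1] by (simp add: vec_eq_iff)

lemma polar_add_left: "polar F (x + y) u = polar F x u + polar F y u"
  using polar_add_right[of u x y] by (simp add: polar_commute)

lemma polar_scale_left: "polar F (c *s x) u = c *s polar F x u"
  using polar_scale_right[of u c x] by (simp add: polar_commute)

lemma polar_self: "polar F x x = 2 *s F x"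
  using add_scale[of x 1 x] add_scale[of x "-1" x] zero by (simp add: vec_eq_iff vector_smult_lneg)

lemma combination: "F (a *s x + b *s u) = a\<^sup>2 *s F x + (a * b) *s polar F x u + b\<^sup>2 *s F u"
  by (simp add: add_scale scale polar_scale_left vector_smult_assoc mult.commute)

lemma poly_fun_polar:
  assumes "\<And>i. poly_fun (\<lambda>p. \<phi> p $ i)" "\<And>i. poly_fun (\<lambda>p. \<psi> p $ i)"
  shows "poly_fun (\<lambda>p. polar F (\<phi> p) (\<psi> p) $ i)"
  unfolding polar_def vector_minus_component
  by (intro poly_fun_intros poly_fun_compose[OF form_poly_fun[OF form_2]]) (auto intro!: poly_fun_intros assms)

end

lemma cubic_deriv_scale_left: "form 3 P \<Longrightarrow> cubic_deriv P (c *s x) u = c\<^sup>2 * cubic_deriv P x u"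
  using form_scale[OF form_cubic_deriv_left] .

lemma cubic_deriv_self:
  assumes "form 3 P"
  shows "cubic_deriv P x x = 3 * P x"
proof -
  have "x + x = 2 *s x" by (simp add: vec_eq_iff)
  then show ?thesis
    using form_scale[OF assms, of 2 x] form_scale[OF assms, of 0 x] by (simp add: cubic_deriv_def)
qed

lemma cubic_combination:
  assumes "form 3 P"
  shows "P (a *s x + b *s u) = a ^ 3 * P x + a\<^sup>2 * b * cubic_deriv P x u
    + a * b\<^sup>2 * cubic_deriv P u x + b ^ 3 * P u"
  using form_3_add_scale[OF assms, of "a *s x" b u] form_scale[OF assms, of a x]
    form_scale[OF form_1_cubic_deriv[OF assms], of u a x]
  by (simp add: cubic_deriv_scale_left[OF assms])

text \<open>In Jordan-theoretic terms \<open>F\<close> and \<open>G\<close> are the adjoint maps,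
  \<open>N\<close> and \<open>M\<close> the cubic norms. The axioms are symmetric under exchanging
  the two pairs.\<close>

locale inverse_quadratic_pair = F: quadratic_map F + G: quadratic_map G
  for F G :: "complex ^ 'n::finite \<Rightarrow> complex ^ 'n" +
  fixes N M :: "complex ^ 'n \<Rightarrow> complex"
  assumes N3: "form 3 N" and M3: "form 3 M"
    and N_nonzero: "\<exists>x. N x \<noteq> 0" and M_nonzero: "\<exists>y. M y \<noteq> 0"
    and GF: "G (F x) = N x *s x" and FG: "F (G y) = M y *s y"
begin

lemma polar_GF: "polar G (F x) (polar F x u) = cubic_deriv N x u *s x + N x *s u"
proof -
  have "polar G (F x) (polar F x u) $ i = (cubic_deriv N x u *s x + N x *s u) $ i" for i
  proof -
    let ?P = "polar F x u"
    have "G (F x + c *s (?P + c *s F u)) = N (x + c *s u) *s (x + c *s u)" for c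
      using GF[of "x + c *s u"] by (simp add: F.add_scale vector_add_ldistrib vector_smult_assoc power2_eq_square add.assoc)
    then have eq: "G (F x + c *s (?P + c *s F u)) $ i = (N (x + c *s u) *s (x + c *s u)) $ i" for c
      by simp
    \<comment> \<open>The coefficients of \<open>c ^ 0\<close> to \<open>c ^ 4\<close> in the
      \<open>i\<close>-th component of the difference of both sides.\<close>
    define a :: "nat \<Rightarrow> complex" where "a = (\<lambda>_. 0)(
      0 := G (F x) $ i - N x * x $ i,
      1 := polar G (F x) ?P $ i - cubic_deriv N x u * x $ i - N x * u $ i,
      2 := polar G (F x) (F u) $ i + G ?P $ i - cubic_deriv N u x * x $ i - cubic_deriv N x u * u $ i,
      3 := polar G ?P (F u) $ i - N u * x $ i - cubic_deriv N u x * u $ i,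
      4 := G (F u) $ i - N u * u $ i)"
    have "a 1 = 0"
    proof (rule linear_coeff_eq_0)
      show "a 0 + c * a 1 + c\<^sup>2 * a 2 + c ^ 3 * a 3 + c ^ 4 * a 4 = 0" for c
        using eq[of c] unfolding G.add_scale G.polar_add_right G.polar_scale_right form_3_add_scale[OF N3]
        by (simp add: a_def algebra_simps eval_nat_numeral)
    qed
    then show ?thesis by (simp add: a_def algebra_simps)
  qed
  then show ?thesis by (simp only: vec_eq_iff) blast
qed

lemma N_eq_0_if_F_eq_0: "F x = 0 \<Longrightarrow> N x = 0"
  using GF[of x] G.zero form_scale[OF N3, of 0 x] by auto

text \<open>Evaluate \<open>F (G (F x))\<close> by \<open>FG\<close> and by \<open>GF\<close>; where
  \<open>N x\<close> is nonzero so is \<open>F x\<close>, which can then be cancelled.\<close>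

lemma M_F: "M (F x) = (N x)\<^sup>2"
proof -
  obtain x\<^sub>0 where "N x\<^sub>0 \<noteq> 0" using N_nonzero by blast
  show ?thesis
  proof (rule poly_fun_eq_on_dense[OF _ _ form_poly_fun[OF N3] \<open>N x\<^sub>0 \<noteq> 0\<close>])
    fix x assume "N x \<noteq> 0"
    then have "F x \<noteq> 0" using N_eq_0_if_F_eq_0 by blast
    moreover have "M (F x) *s F x = (N x)\<^sup>2 *s F x"
      using FG[of "F x"] unfolding GF F.scale by (rule sym)
    ultimately show "M (F x) = (N x)\<^sup>2" by (metis vec.scale_right_imp_eq)
  qed (auto intro!: poly_fun_intros form_poly_fun[OF N3] poly_fun_compose[OF form_poly_fun[OF M3]]
        form_poly_fun[OF F.form_2])
qed

end

text \<open>Every lemma becomes available with the roles exchanged; for instance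
  \<open>swap.M_F\<close> says that \<open>N (G y)\<close> is the square of
  \<open>M y\<close>.\<close>

sublocale inverse_quadratic_pair \<subseteq> swap: inverse_quadratic_pair G F M N
  by unfold_locales (auto simp: N3 M3 GF FG N_nonzero M_nonzero)

context inverse_quadratic_pair
begin

lemma trace_form_at:
  assumes G: "no_common_factor G"
  shows "\<exists>H. form 1 H \<and> (\<forall>y. polar G y (polar F (G y) u) = H y *s G y + M y *s u)
    \<and> (\<forall>x. cubic_deriv N x u = H (F x))"
proof -
  note pF = form_poly_fun[OF F.form_2] and pG = form_poly_fun[OF G.form_2]
    and pN = form_poly_fun[OF N3] and pM = form_poly_fun[OF M3]
  obtain x\<^sub>0 where x\<^sub>0: "N x\<^sub>0 \<noteq> 0" using N_nonzero by blast
  obtain y\<^sub>0 where y\<^sub>0: "M y\<^sub>0 \<noteq> 0" using M_nonzero by blast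
  then have "G y\<^sub>0 \<noteq> 0" using swap.N_eq_0_if_F_eq_0 by blast
  then obtain k where k: "G y\<^sub>0 $ k \<noteq> 0" by (auto simp: vec_eq_iff)
  define K where "K y = cubic_deriv N (G y) u" for y
  have K: "form (2 * 2) K" unfolding K_def
    by (rule form_compose[OF form_cubic_deriv_left[OF N3] G.form_2])
  define A where "A i y = (polar G y (polar F (G y) u) - M y *s u) $ i" for i y
  have pA: "poly_fun (A i)" for i
    unfolding A_def
    by (auto intro!: poly_fun_intros G.poly_fun_polar F.poly_fun_polar pM pG)
  \<comment> \<open>This is \<open>polar_GF\<close> at \<open>G y\<close>, with \<open>FG\<close>
    and \<open>swap.M_F\<close> inserted and one factor \<open>M y\<close> cancelled in the term
    along \<open>u\<close>.\<close>
  have MA: "M y * A i y = K y * G y $ i" for i y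
    using polar_GF[of "G y" u]
    by (auto simp: FG G.polar_scale_left swap.M_F K_def A_def vec_eq_iff algebra_simps power2_eq_square)
  have "A i y * G y $ j = A j y * G y $ i" for i j y
  proof (rule poly_fun_mult_left_cancel[where x = y, OF _ _ pM y\<^sub>0])
    show "M y * (A i y * G y $ j) = M y * (A j y * G y $ i)" for y
      using MA[of y i] MA[of y j] by (metis mult.assoc mult.commute)
  qed (intro poly_fun_intros pA pG)+
  then obtain H where H: "poly_fun H" "\<And>i y. A i y = H y * G y $ i"
    using proportional_to_primitive_quadratic[OF G.form_2 G \<open>G y\<^sub>0 \<noteq> 0\<close>, of A] pA by blast
  have KMH: "K y = M y * H y" for y
  proof (rule poly_fun_mult_left_cancel[where x = y, OF _ _ pG k])
    show "G y $ k * K y = G y $ k * (M y * H y)" for y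
      using MA[of y k] unfolding H(2) by (simp only: ac_simps)
  qed (intro form_poly_fun[OF K] poly_fun.mult pM H(1))+
  have H1: "form 1 H"
    by (rule form_right_factor[OF M3 _ H(1) y\<^sub>0 KMH]) (use K in \<open>simp add: eval_nat_numeral\<close>)
  \<comment> \<open>Substituting \<open>y = F x\<close> in \<open>KMH\<close> turns both sides into
    multiples of the square of \<open>N x\<close>.\<close>
  have "cubic_deriv N x u = H (F x)" for x
  proof (rule poly_fun_mult_left_cancel[where x = x, OF _ _ poly_fun_power[OF pN, of 2]])
    show "(N x)\<^sup>2 * cubic_deriv N x u = (N x)\<^sup>2 * H (F x)" for x
      using KMH[of "F x"] by (simp add: K_def GF cubic_deriv_scale_left[OF N3] M_F)
    show "poly_fun (\<lambda>x. cubic_deriv N x u)" by (rule form_poly_fun[OF form_cubic_deriv_left[OF N3]])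
    show "poly_fun (\<lambda>x. H (F x))" by (rule poly_fun_compose[OF H(1) pF])
    show "(N x\<^sub>0)\<^sup>2 \<noteq> 0" using x\<^sub>0 by simp
  qed
  moreover have "polar G y (polar F (G y) u) = H y *s G y + M y *s u" for y
    using H(2)[of _ y] by (simp add: A_def vec_eq_iff algebra_simps)
  ultimately show ?thesis using H1 by blast
qed

lemma trace_form_exists:
  assumes G: "no_common_factor G"
  obtains t where "\<And>u. form 1 (\<lambda>y. t y u)" "\<And>y. form 1 (t y)"
    "\<And>x u. cubic_deriv N x u = t (F x) u"
    "\<And>y u. polar G y (polar F (G y) u) = t y u *s G y + M y *s u"
proof -
  obtain t where t: "\<And>u. form 1 (t u)" "\<And>u y. polar G y (polar F (G y) u) = t u y *s G y + M y *s u"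
    "\<And>u x. cubic_deriv N x u = t u (F x)"
    using trace_form_at[OF G] by metis
  obtain y\<^sub>0 where "M y\<^sub>0 \<noteq> 0" using M_nonzero by blast
  then have "G y\<^sub>0 \<noteq> 0" using swap.N_eq_0_if_F_eq_0 by blast
  then obtain k where k: "G y\<^sub>0 $ k \<noteq> 0" by (auto simp: vec_eq_iff)
  \<comment> \<open>The choice of \<open>t u\<close> for each \<open>u\<close> gives no linearity in
    \<open>u\<close>. Where \<open>G y $ k\<close> is nonzero, \<open>t u y\<close> is determined by
    an expression linear in \<open>u\<close>; density does the rest.\<close>
  have t_sum: "t u y = (\<Sum>j\<in>UNIV. u $ j * t (axis j 1) y)" for u y
  proof (rule poly_fun_eq_on_dense[OF _ _ form_poly_fun[OF G.form_2] k])
    fix y assume y: "G y $ k \<noteq> 0"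
    let ?L = "\<lambda>u. polar G y (polar F (G y) u) $ k - M y * u $ k"
    have "form (1 * 1) (\<lambda>u. polar G y (polar F (G y) u) $ k)"
      by (rule form_compose[OF G.polar_form_1 F.polar_form_1])
    then have L: "form 1 ?L" by (intro form_diff form_cmult form_coord) simp
    have "t u y = ?L u / G y $ k" for u using t(2)[of y u] y by simp
    then show "t u y = (\<Sum>j\<in>UNIV. u $ j * t (axis j 1) y)"
      by (simp add: form_1_eq_sum[OF L, of u] sum_divide_distrib)
  qed (auto intro!: poly_fun_intros form_poly_fun[OF t(1)])
  have "form 1 (\<lambda>u. t u y)" for y
    unfolding form_def
  proof (intro conjI allI)
    show "poly_fun (\<lambda>u. t u y)" by (subst t_sum) (auto intro!: poly_fun_intros)
    show "t (c *s u) y = c ^ 1 * t u y" for c u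
      by (subst (1 2) t_sum) (simp add: sum_distrib_left mult.assoc)
  qed
  then show thesis using that[of "\<lambda>y u. t u y"] t by blast
qed

end

text \<open>The two orders of the pair give bilinear forms \<open>t\<close> and \<open>t'\<close>;
  the point is that they are transposes of each other.\<close>

lemma (in inverse_quadratic_pair) symmetric_trace_form_exists:
  assumes "no_common_factor F" "no_common_factor G"
  obtains t where "\<And>u. form 1 (\<lambda>y. t y u)" "\<And>y. form 1 (t y)"
    "\<And>x u. cubic_deriv N x u = t (F x) u" "\<And>y v. cubic_deriv M y v = t v (G y)"
    "\<And>x v. polar F x (polar G (F x) v) = t v x *s F x + N x *s v"
proof -
  obtain t where t: "\<And>u. form 1 (\<lambda>y. t y u)" "\<And>y. form 1 (t y)"
    "\<And>x u. cubic_deriv N x u = t (F x) u"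
    using trace_form_exists[OF assms(2)] by metis
  obtain t' where t': "\<And>v. form 1 (\<lambda>x. t' x v)" "\<And>x. form 1 (t' x)"
    "\<And>y v. cubic_deriv M y v = t' (G y) v"
    "\<And>x v. polar F x (polar G (F x) v) = t' x v *s F x + N x *s v"
    using swap.trace_form_exists[OF assms(1)] by metis
  note pN = form_poly_fun[OF N3] and pF = form_poly_fun[OF F.form_2]
  obtain x\<^sub>0 where x\<^sub>0: "N x\<^sub>0 \<noteq> 0" using N_nonzero by blast
  obtain y\<^sub>0 where y\<^sub>0: "M y\<^sub>0 \<noteq> 0" using M_nonzero by blast
  have t'_sum: "t' x v = (\<Sum>j\<in>UNIV. v $ j * t' x (axis j 1))" for x v
    by (rule form_1_eq_sum[OF t'(2)])
  have pt': "poly_fun (\<lambda>z. t' (\<phi> z) (\<psi> z))"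
    if "\<And>i. poly_fun (\<lambda>z. \<phi> z $ i)" "\<And>i. poly_fun (\<lambda>z. \<psi> z $ i)" for \<phi> \<psi> :: "complex ^ 'n \<Rightarrow> complex ^ 'n"
    by (subst t'_sum) (auto intro!: poly_fun_intros that poly_fun_compose[OF form_poly_fun[OF t'(1)]])
  \<comment> \<open>\<open>polar F x (polar G (F x) (polar F x u))\<close> is evaluated in two ways,
    by the identity for \<open>t'\<close> and by the one for \<open>t\<close>.\<close>
  have polarF: "t' x (polar F x u) = 2 * t (F x) u" for x u
  proof (rule poly_fun_eq_on_dense[where x = x, OF _ _ pN x\<^sub>0])
    fix x assume "N x \<noteq> 0"
    then have "F x \<noteq> 0" using N_eq_0_if_F_eq_0 by blast
    have "t' x (polar F x u) *s F x + N x *s polar F x u = polar F x (t (F x) u *s x + N x *s u)"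
      using t'(4)[of x "polar F x u"] polar_GF[of x u] t(3) by simp
    also have "\<dots> = (2 * t (F x) u) *s F x + N x *s polar F x u"
      by (simp add: F.polar_add_right F.polar_scale_right F.polar_self vector_smult_assoc mult.commute)
    finally have "t' x (polar F x u) *s F x = (2 * t (F x) u) *s F x" by simp
    then show "t' x (polar F x u) = 2 * t (F x) u"
      using \<open>F x \<noteq> 0\<close> vec.scale_right_imp_eq by blast
  qed (auto intro!: poly_fun_intros pt' F.poly_fun_polar poly_fun_compose[OF form_poly_fun[OF t(1)]] pF)
  have t'F: "t' x (F x) = 3 * N x" for x
    using polarF[of x x] t(3)[of x x] form_scale[OF t'(2), of x 2 "F x"]
    by (simp add: F.polar_self cubic_deriv_self[OF N3])
  \<comment> \<open>The terms of \<open>t'F\<close> linear in \<open>u\<close> give three copies of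
    \<open>t (F x) u\<close>, two of which are \<open>t' x (polar F x u)\<close>.\<close>
  have t'tF: "t' u (F x) = t (F x) u" for x u
  proof -
    have "t' u (F x) + t' x (polar F x u) - 3 * t (F x) u = 0"
    proof -
      define a :: "nat \<Rightarrow> complex" where "a = (\<lambda>_. 0)(
        0 := t' x (F x) - 3 * N x,
        1 := t' u (F x) + t' x (polar F x u) - 3 * t (F x) u,
        2 := t' u (polar F x u) + t' x (F u) - 3 * t (F u) x,
        3 := t' u (F u) - 3 * N u)"
      have "a 1 = 0"
      proof (rule linear_coeff_eq_0)
        fix c
        have "t' (x + c *s u) (F (x + c *s u)) = 3 * N (x + c *s u)" by (rule t'F)
        then show "a 0 + c * a 1 + c\<^sup>2 * a 2 + c ^ 3 * a 3 + c ^ 4 * a 4 = 0"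
          unfolding F.add_scale form_3_add_scale[OF N3] form_1_add_scale[OF t'(1)] form_1_add_scale[OF t'(2)]
          by (simp add: a_def t(3) algebra_simps eval_nat_numeral)
      qed
      then show ?thesis by (simp add: a_def)
    qed
    then show ?thesis using polarF[of x u] by simp
  qed
  \<comment> \<open>Put \<open>x = G y\<close> in \<open>t'tF\<close> and cancel
    \<open>M y\<close>.\<close>
  have "t' u y = t y u" for y u
  proof (rule poly_fun_eq_on_dense[where x = y, OF _ _ form_poly_fun[OF M3] y\<^sub>0])
    fix y assume "M y \<noteq> 0"
    moreover have "M y * t' u y = M y * t y u"
      using t'tF[of u "G y"] form_scale[OF t(1)] form_scale[OF t'(2)] by (simp add: FG)
    ultimately show "t' u y = t y u" by simp
  qed (intro form_poly_fun[OF t(1)] form_poly_fun[OF t'(2)])+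
  then show thesis using that t t' by metis
qed

text \<open>\<open>t\<close> corresponds to the trace form of a cubic Jordan structure, pairing the
  two copies of the space.\<close>

locale quadro_quadric = inverse_quadratic_pair F G N M
  for F G :: "complex ^ 'n::finite \<Rightarrow> complex ^ 'n" and N M +
  fixes t :: "complex ^ 'n \<Rightarrow> complex ^ 'n \<Rightarrow> complex"
  assumes t_form_left: "form 1 (\<lambda>y. t y u)" and t_form_right: "form 1 (t y)"
    and N_deriv: "cubic_deriv N x u = t (F x) u" and M_deriv: "cubic_deriv M y v = t v (G y)"
    and polar_FG: "polar F x (polar G (F x) v) = t v x *s F x + N x *s v"
begin

lemma poly_fun_t:
  assumes "\<And>i. poly_fun (\<lambda>p. \<phi> p $ i)" "\<And>i. poly_fun (\<lambda>p. \<psi> p $ i)"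
  shows "poly_fun (\<lambda>p. t (\<phi> p) (\<psi> p))"
  by (subst form_1_eq_sum[OF t_form_right])
    (auto intro!: poly_fun_intros assms poly_fun_compose[OF form_poly_fun[OF t_form_left]])

lemmas t_bilinear =
  form_1_add[OF t_form_left] form_1_add[OF t_form_right]
  form_1_diff[OF t_form_left] form_1_diff[OF t_form_right]
  form_scale[OF t_form_left, unfolded power_one_right] form_scale[OF t_form_right, unfolded power_one_right]

lemma t_F_self: "t (F x) x = 3 * N x"
  using N_deriv[of x x] cubic_deriv_self[OF N3] by simp

lemma F_combination: "F (a *s u + b *s v) = a\<^sup>2 *s F u + (a * b) *s polar F u v + b\<^sup>2 *s F v"
  by (rule F.combination)

lemma G_combination:
  "G (a *s F u + b *s F v) = (a\<^sup>2 * N u) *s u + (a * b) *s polar G (F u) (F v) + (b\<^sup>2 * N v) *s v"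
  by (simp add: G.combination GF vector_smult_assoc)

lemma N_combination:
  "N (a *s u + b *s v) = a ^ 3 * N u + a\<^sup>2 * b * t (F u) v + a * b\<^sup>2 * t (F v) u + b ^ 3 * N v"
  by (simp add: cubic_combination[OF N3] N_deriv)

lemma M_combination:
  "M (a *s F u + b *s F v) = a ^ 3 * (N u)\<^sup>2 + a\<^sup>2 * b * N u * t (F v) u
     + a * b\<^sup>2 * N v * t (F u) v + b ^ 3 * (N v)\<^sup>2"
  by (simp add: cubic_combination[OF M3] M_deriv GF M_F t_bilinear)

lemma t_combination:
  "t (a *s F u + b *s F v) (a *s u + b *s v) =
     3 * a\<^sup>2 * N u + a * b * (t (F u) v + t (F v) u) + 3 * b\<^sup>2 * N v"
  by (simp add: t_bilinear t_F_self algebra_simps power2_eq_square)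

text \<open>The mixed polarizations with \<open>polar F u v\<close> reduce to \<open>u\<close> and
  \<open>v\<close> by \<open>polar_GF\<close>. The dual lemma after this one uses
  \<open>polar_FG\<close> instead.\<close>

lemma polar_G_combination:
  "polar G (a *s F u + b *s F v) (F (a *s u + b *s v)) =
     (2 * a ^ 3 * N u) *s u + (a\<^sup>2 * b) *s (t (F u) v *s u + N u *s v)
     + (a\<^sup>2 * b + a * b\<^sup>2) *s polar G (F u) (F v)
     + (a * b\<^sup>2) *s (t (F v) u *s v + N v *s u) + (2 * b ^ 3 * N v) *s v"
proof -
  have "polar G (F u) (polar F u v) = t (F u) v *s u + N u *s v"
    "polar G (F v) (polar F u v) = t (F v) u *s v + N v *s u"
    using polar_GF[of u v] polar_GF[of v u] by (simp_all add: N_deriv polar_commute[of F u v])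
  then show ?thesis
    by (simp add: F_combination G.polar_add_left G.polar_add_right G.polar_scale_left G.polar_scale_right
        G.polar_self GF polar_commute[of G "F v" "F u"] vec_eq_iff algebra_simps eval_nat_numeral)
qed

lemma polar_F_combination:
  "polar F (a *s u + b *s v) (G (a *s F u + b *s F v)) =
     (2 * a ^ 3 * N u) *s F u + (a\<^sup>2 * b) *s (t (F v) u *s F u + N u *s F v)
     + (a\<^sup>2 * b * N u + a * b\<^sup>2 * N v) *s polar F u v
     + (a * b\<^sup>2) *s (t (F u) v *s F v + N v *s F u) + (2 * b ^ 3 * N v) *s F v"
proof -
  have "polar F u (polar G (F u) (F v)) = t (F v) u *s F u + N u *s F v"
    "polar F v (polar G (F u) (F v)) = t (F u) v *s F v + N v *s F u"
    using polar_FG[of u "F v"] polar_FG[of v "F u"] by (simp_all add: polar_commute[of G "F u" "F v"])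
  then show ?thesis
    by (simp add: G_combination F.polar_add_left F.polar_add_right F.polar_scale_left F.polar_scale_right
        F.polar_self polar_commute[of F v u] vec_eq_iff algebra_simps eval_nat_numeral)
qed

end

section \<open>The cubic involution\<close>

definition ambient_vec :: "complex \<Rightarrow> complex ^ 'n::finite \<Rightarrow> complex ^ 'n \<Rightarrow> complex \<Rightarrow> complex ^ 'n ambient" where
  "ambient_vec r x y s =
     (\<chi> k. case k of Inl _ \<Rightarrow> r | Inr (Inl i) \<Rightarrow> x $ i | Inr (Inr (Inl i)) \<Rightarrow> y $ i | Inr (Inr (Inr _)) \<Rightarrow> s)"

definition r_of :: "complex ^ 'n::finite ambient \<Rightarrow> complex" where "r_of p = p $ Inl ()"
definition x_of :: "complex ^ 'n::finite ambient \<Rightarrow> complex ^ 'n" where "x_of p = (\<chi> i. p $ Inr (Inl i))"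
definition y_of :: "complex ^ 'n::finite ambient \<Rightarrow> complex ^ 'n" where "y_of p = (\<chi> i. p $ Inr (Inr (Inl i)))"
definition s_of :: "complex ^ 'n::finite ambient \<Rightarrow> complex" where "s_of p = p $ Inr (Inr (Inr ()))"

lemma ambient_vec_parts [simp]:
  "r_of (ambient_vec r x y s) = r" "x_of (ambient_vec r x y s) = x"
  "y_of (ambient_vec r x y s) = y" "s_of (ambient_vec r x y s) = s"
  by (simp_all add: r_of_def x_of_def y_of_def s_of_def ambient_vec_def)

lemma ambient_eq_iff: "p = q \<longleftrightarrow> r_of p = r_of q \<and> x_of p = x_of q \<and> y_of p = y_of q \<and> s_of p = s_of q"
proof
  assume *: "r_of p = r_of q \<and> x_of p = x_of q \<and> y_of p = y_of q \<and> s_of p = s_of q"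
  have "p $ k = q $ k" for k
  proof (cases k)
    case (Inl u)
    then show ?thesis using * by (simp add: r_of_def)
  next
    case (Inr k')
    note k = Inr
    show ?thesis
    proof (cases k')
      case (Inl i)
      then show ?thesis using k * by (simp add: x_of_def vec_eq_iff)
    next
      case (Inr k'')
      then show ?thesis using k * by (cases k'') (simp_all add: y_of_def s_of_def vec_eq_iff)
    qed
  qed
  then show "p = q" by (simp add: vec_eq_iff)
qed simp

lemma parts_linear [simp]:
  "r_of (p + q) = r_of p + r_of q" "x_of (p + q) = x_of p + x_of q"
  "y_of (p + q) = y_of p + y_of q" "s_of (p + q) = s_of p + s_of q"
  "r_of (p - q) = r_of p - r_of q" "x_of (p - q) = x_of p - x_of q"
  "y_of (p - q) = y_of p - y_of q" "s_of (p - q) = s_of p - s_of q"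
  "r_of (c *s p) = c * r_of p" "x_of (c *s p) = c *s x_of p"
  "y_of (c *s p) = c *s y_of p" "s_of (c *s p) = c * s_of p"
  "r_of 0 = 0" "x_of 0 = 0" "y_of 0 = 0" "s_of 0 = 0"
  by (simp_all add: r_of_def x_of_def y_of_def s_of_def vec_eq_iff)

lemma X_param_eq: "X_param F N x = ambient_vec 1 x (F x) (N x)"
  by (simp add: X_param_def ambient_vec_def)

lemma X_param_parts [simp]:
  "r_of (X_param F N x) = 1" "x_of (X_param F N x) = x"
  "y_of (X_param F N x) = F x" "s_of (X_param F N x) = N x"
  by (simp_all add: X_param_eq)

lemma form_parts:
  "form 1 r_of" "form 1 s_of" "form 1 (\<lambda>p. x_of p $ i)" "form 1 (\<lambda>p. y_of p $ i)"
  using form_coord unfolding r_of_def s_of_def x_of_def y_of_def by simp_all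

lemmas poly_fun_parts = form_parts[THEN form_poly_fun]

lemma poly_fun_ambient_vec:
  assumes "poly_fun R" "\<And>i. poly_fun (\<lambda>p. A p $ i)" "\<And>i. poly_fun (\<lambda>p. B p $ i)" "poly_fun S"
  shows "poly_fun (\<lambda>p. ambient_vec (R p) (A p) (B p) (S p) $ k)"
proof (cases k)
  case (Inr k')
  then show ?thesis using assms
    by (cases k'; cases "projr k'") (auto simp: ambient_vec_def)
qed (simp add: ambient_vec_def assms)

context quadro_quadric
begin

abbreviation X :: "complex ^ 'n \<Rightarrow> complex ^ 'n ambient" where
  "X \<equiv> X_param F N"

definition defect :: "complex ^ 'n ambient \<Rightarrow> complex" where
  "defect p = t (y_of p) (x_of p) - r_of p * s_of p"

text \<open>With \<open>x = x_of p\<close> and so on, consider the quartic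
  \<open>(defect p)^2 - 4 * t (F x) (G y) + 4 * r * M y + 4 * s * N x\<close>. The outer components
  are minus half its derivative in \<open>s\<close> and half its derivative in \<open>r\<close>; the
  inner ones represent, through \<open>t\<close>, half its derivative in \<open>y\<close> and minus
  half that in \<open>x\<close>.\<close>

definition Phi :: "complex ^ 'n ambient \<Rightarrow> complex ^ 'n ambient" where
  "Phi p = ambient_vec
     (r_of p * defect p - 2 * N (x_of p))
     ((2 * r_of p) *s G (y_of p) - 2 *s polar G (y_of p) (F (x_of p)) + defect p *s x_of p)
     (2 *s polar F (x_of p) (G (y_of p)) - (2 * s_of p) *s F (x_of p) - defect p *s y_of p)
     (2 * M (y_of p) - s_of p * defect p)"

lemma N_diff: "N (u - v) = N u - t (F u) v + t (F v) u - N v"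
  using N_combination[of 1 u "-1" v] by (simp add: vector_smult_lneg)

lemma F_diff: "F (u - v) = F u - polar F u v + F v"
  using F_combination[of 1 u "-1" v] by (simp add: vector_smult_lneg)

text \<open>In the two inner components the multiples of \<open>polar G (F u) (F v)\<close> and
  \<open>polar F u v\<close> cancel; the remaining coefficients collect to \<open>N (u - v)\<close>
  as expanded in \<open>N_diff\<close>.\<close>

lemma Phi_combination:
  "Phi (a *s X u + b *s X v) = (a * b * N (u - v)) *s (a *s X u - b *s X v)"
proof -
  let ?p = "a *s X u + b *s X v"
  have d: "defect ?p = 3 * a\<^sup>2 * N u + a * b * (t (F u) v + t (F v) u) + 3 * b\<^sup>2 * N v
     - (a + b) * (a * N u + b * N v)"
    by (simp add: defect_def t_combination)
  have "r_of (Phi ?p) = a * b * N (u - v) * (a - b)"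
    by (simp add: Phi_def d N_combination N_diff algebra_simps eval_nat_numeral)
  moreover have "s_of (Phi ?p) = a * b * N (u - v) * (a * N u - b * N v)"
    by (simp add: Phi_def d M_combination N_diff algebra_simps eval_nat_numeral)
  moreover have "x_of (Phi ?p) = (a * b * N (u - v)) *s (a *s u - b *s v)"
    by (simp add: Phi_def d polar_G_combination G_combination N_diff vec_eq_iff algebra_simps eval_nat_numeral)
  moreover have "y_of (Phi ?p) = (a * b * N (u - v)) *s (a *s F u - b *s F v)"
    by (simp add: Phi_def d polar_F_combination F_combination N_diff vec_eq_iff algebra_simps eval_nat_numeral)
  ultimately show ?thesis by (simp add: ambient_eq_iff right_diff_distrib)
qed

lemma defect_scale: "defect (c *s p) = c\<^sup>2 * defect p"
  by (simp add: defect_def t_bilinear algebra_simps power2_eq_square)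

lemma Phi_scale: "Phi (c *s p) = c ^ 3 *s Phi p"
  by (simp add: ambient_eq_iff Phi_def defect_scale F.scale G.scale F.polar_scale_left F.polar_scale_right
      G.polar_scale_left G.polar_scale_right form_scale[OF N3] form_scale[OF M3] vec_eq_iff
      algebra_simps eval_nat_numeral)

lemma poly_fun_on_parts:
  "poly_fun (\<lambda>p. F (x_of p) $ i)" "poly_fun (\<lambda>p. G (y_of p) $ i)"
  "poly_fun (\<lambda>p. N (x_of p))" "poly_fun (\<lambda>p. M (y_of p))" "poly_fun defect"
  unfolding defect_def
  by (intro poly_fun_intros poly_fun_t poly_fun_parts form_poly_fun[OF N3] form_poly_fun[OF M3]
      poly_fun_compose[OF form_poly_fun[OF N3]] poly_fun_compose[OF form_poly_fun[OF M3]]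
      poly_fun_compose[OF form_poly_fun[OF F.form_2]] poly_fun_compose[OF form_poly_fun[OF G.form_2]])+

lemma form_3_Phi: "form 3 (\<lambda>p. Phi p $ k)"
proof -
  have "poly_fun (\<lambda>p. Phi p $ k)"
    unfolding Phi_def
    by (intro poly_fun_ambient_vec)
      (auto intro!: poly_fun_intros poly_fun_parts poly_fun_on_parts F.poly_fun_polar G.poly_fun_polar)
  then show ?thesis by (simp add: form_def Phi_scale)
qed

text \<open>At \<open>p = a X(u) + b X(v)\<close> these are \<open>a b F(u - v)\<close> and \<open>a b (b - a) N(u - v)\<close>, so that \<open>disc p\<close> is the
  square of \<open>a b (a + b) N(u - v)\<close>. Choosing a root \<open>W\<close> of it is choosing an order of the two points:
  \<open>b - a = r S / W\<close> and \<open>u - v = (W / (r M(Y))) G(Y)\<close>.\<close>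

definition Y_part :: "complex ^ 'n ambient \<Rightarrow> complex ^ 'n" where
  "Y_part p = r_of p *s y_of p - F (x_of p)"

definition S_part :: "complex ^ 'n ambient \<Rightarrow> complex" where
  "S_part p = 2 * N (x_of p) - r_of p * defect p"

definition disc :: "complex ^ 'n ambient \<Rightarrow> complex" where
  "disc p = (S_part p)\<^sup>2 + 4 * M (Y_part p)"

lemma Y_combination: "Y_part (a *s X u + b *s X v) = (a * b) *s F (u - v)"
  by (simp add: Y_part_def F_combination F_diff vec_eq_iff algebra_simps power2_eq_square)

lemma S_combination: "S_part (a *s X u + b *s X v) = a * b * (b - a) * N (u - v)"
  by (simp add: S_part_def defect_def t_combination N_combination N_diff algebra_simps eval_nat_numeral)

lemma M_Y_combination: "M (Y_part (a *s X u + b *s X v)) = (a * b) ^ 3 * (N (u - v))\<^sup>2"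
  by (simp add: Y_combination form_scale[OF M3] M_F)

lemma disc_combination: "disc (a *s X u + b *s X v) = (a * b * (a + b) * N (u - v))\<^sup>2"
  by (simp add: disc_def S_combination M_Y_combination algebra_simps eval_nat_numeral)

text \<open>The product of the denominators in the decomposition. At
  \<open>a *s X u + b *s X v\<close> it equals
  \<open>(a + b)^3 * (a * b)^5 * N (u - v)^4\<close>.\<close>

definition genericity :: "complex ^ 'n ambient \<Rightarrow> complex" where
  "genericity p = r_of p * M (Y_part p) * disc p"

text \<open>The degree is \<open>1 + 6 + 6\<close>, since \<open>Y_part\<close> is quadratic and
  \<open>S_part\<close> cubic.\<close>

lemma form_genericity: "form 13 genericity"
proof -
  have "poly_fun (\<lambda>p. Y_part p $ i)" for i
    unfolding Y_part_def by (auto intro!: poly_fun_intros poly_fun_parts poly_fun_on_parts)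
  then have "poly_fun genericity"
    unfolding genericity_def disc_def S_part_def
    by (intro poly_fun_intros poly_fun_parts poly_fun_on_parts poly_fun_compose[OF form_poly_fun[OF M3]])
  moreover have "Y_part (c *s p) = c\<^sup>2 *s Y_part p" "S_part (c *s p) = c ^ 3 * S_part p" for c p
    by (simp_all add: Y_part_def S_part_def defect_scale F.scale form_scale[OF N3] vec_eq_iff
        algebra_simps eval_nat_numeral)
  then have "genericity (c *s p) = c ^ 13 * genericity p" for c p
    by (simp add: genericity_def disc_def form_scale[OF M3] power_mult_distrib algebra_simps eval_nat_numeral)
  ultimately show ?thesis by (simp add: form_def)
qed

lemma genericity_nonzero: "\<exists>p. genericity p \<noteq> 0"
proof -
  obtain y where "M y \<noteq> 0" using M_nonzero by blast
  moreover have "N 0 = 0" using form_scale[OF N3, of 0 0] by simp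
  ultimately have "genericity (ambient_vec 1 0 y 0) \<noteq> 0"
    using form_scale[OF t_form_right, of y 0 0]
    by (simp add: genericity_def disc_def S_part_def Y_part_def defect_def F.zero)
  then show ?thesis by blast
qed

lemma genericity_0: "genericity 0 = 0"
  by (simp add: genericity_def)

lemma secant_decomposition:
  assumes "genericity p \<noteq> 0"
  obtains a b u v where "p = a *s X u + b *s X v"
proof -
  define r x where "r = r_of p" and "x = x_of p"
  define Y S m where "Y = Y_part p" and "S = S_part p" and "m = M Y"
  define W where "W = csqrt (disc p)"
  have W2: "W\<^sup>2 = S\<^sup>2 + 4 * m" by (simp add: W_def disc_def S_def m_def Y_def)
  have nz: "r \<noteq> 0" "m \<noteq> 0" "W \<noteq> 0"
    using assms by (auto simp: genericity_def r_def m_def Y_def W_def)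
  define a b where "a = (r - r * S / W) / 2" and "b = (r + r * S / W) / 2"
  define d where "d = (W / (r * m)) *s G Y"
  \<comment> \<open>These solve \<open>a *s u + b *s v = x\<close> and \<open>u - v = d\<close>,
    given that \<open>a + b = r\<close>.\<close>
  define u v where "u = (1 / r) *s (x + b *s d)" and "v = (1 / r) *s (x - a *s d)"
  have ab: "a + b = r" "b - a = r * S / W" by (simp_all add: a_def b_def field_simps)
  have "4 * (a * b) = (a + b)\<^sup>2 - (b - a)\<^sup>2" by (simp add: algebra_simps power2_eq_square)
  also have "\<dots> = r\<^sup>2 * (W\<^sup>2 - S\<^sup>2) / W\<^sup>2"
    unfolding ab using nz by (simp add: field_simps)
  also have "\<dots> = 4 * (r\<^sup>2 * m / W\<^sup>2)" by (simp add: W2)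
  finally have prod: "a * b = r\<^sup>2 * m / W\<^sup>2" by (simp only: mult_cancel_left) simp
  have uv: "u - v = d"
  proof -
    have "u - v = ((a + b) / r) *s d" by (simp add: u_def v_def vec_eq_iff field_simps add_divide_distrib)
    then show ?thesis using ab nz by simp
  qed
  \<comment> \<open>\<open>?q\<close> and \<open>p\<close> share \<open>r_of\<close>,
    \<open>x_of\<close>, \<open>Y_part\<close> and \<open>S_part\<close>. As \<open>r\<close> is
    nonzero, \<open>Y_part\<close> recovers \<open>y_of\<close>, and \<open>S_part\<close> recovers
    \<open>defect\<close> and then \<open>s_of\<close>.\<close>
  let ?q = "a *s X u + b *s X v"
  have rq: "r_of ?q = r_of p" using ab(1) by (simp add: r_def)
  have xq: "x_of ?q = x_of p"
  proof -
    have "a *s u + b *s v = ((a + b) / r) *s x"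
      by (simp add: u_def v_def vec_eq_iff field_simps add_divide_distrib)
    then show ?thesis using ab nz by (simp add: x_def)
  qed
  have Fd: "F d = (W\<^sup>2 / (r\<^sup>2 * m)) *s Y"
    using nz by (simp add: d_def F.scale FG m_def[symmetric] vector_smult_assoc field_simps power2_eq_square)
  have "N d = W ^ 3 / (r ^ 3 * m)"
    using nz by (simp add: d_def form_scale[OF N3] swap.M_F m_def[symmetric] field_simps eval_nat_numeral)
  have Yq: "Y_part ?q = Y_part p"
    using nz by (simp add: Y_combination uv Fd prod vector_smult_assoc Y_def[symmetric])
  have Sq: "S_part ?q = S_part p"
    unfolding S_combination uv prod ab(2) \<open>N d = _\<close> using nz by (simp add: S_def field_simps eval_nat_numeral)
  have "r_of p *s y_of ?q = r_of p *s y_of p"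
    using Yq rq xq by (simp add: Y_part_def)
  from vec.scale_left_imp_eq[OF nz(1)[unfolded r_def] this] have yq: "y_of ?q = y_of p" .
  have "r_of p * defect ?q = r_of p * defect p"
    using Sq rq xq by (simp add: S_part_def)
  then have "defect ?q = defect p" using nz unfolding r_def by simp
  then have "r_of p * s_of ?q = r_of p * s_of p"
    using rq xq yq by (simp add: defect_def)
  then have "s_of ?q = s_of p" using nz unfolding r_def by simp
  then have "p = ?q" using rq xq yq ambient_eq_iff by metis
  then show thesis by (rule that)
qed

lemma generic_combination_nonzero:
  assumes "genericity (a *s X u + b *s X v) \<noteq> 0"
  shows "a \<noteq> 0" "b \<noteq> 0" "a + b \<noteq> 0" "N (u - v) \<noteq> 0"
  using assms by (auto simp: genericity_def M_Y_combination disc_combination)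

lemma secant_decomposition_unique:
  assumes "genericity p \<noteq> 0" "p = a *s X u + b *s X v" "p = a' *s X u' + b' *s X v'"
  shows "(a = a' \<and> b = b' \<and> u = u' \<and> v = v') \<or> (a = b' \<and> b = a' \<and> u = v' \<and> v = u')"
proof -
  \<comment> \<open>Equal square roots of \<open>disc p\<close> force equal ordered decompositions:
    \<open>r_of\<close> and \<open>S_part\<close> give \<open>a\<close> and \<open>b\<close>,
    \<open>Y_part\<close> gives \<open>F (u - v)\<close> and, through \<open>G\<close>, also
    \<open>u - v\<close>, and \<open>x_of\<close> gives \<open>v\<close>.\<close>
  have main: "a = a' \<and> b = b' \<and> u = u' \<and> v = v'"
    if p: "p = a *s X u + b *s X v" and p': "p = a' *s X u' + b' *s X v'"
      and W: "a * b * (a + b) * N (u - v) = a' * b' * (a' + b') * N (u' - v')" for a b u v a' b' u' v'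
  proof -
    note nz = generic_combination_nonzero[OF assms(1)[unfolded p]]
    note nz' = generic_combination_nonzero[OF assms(1)[unfolded p']]
    have r: "a + b = a' + b'" using arg_cong[OF p, of r_of] arg_cong[OF p', of r_of] by simp
    then have W': "a * b * N (u - v) = a' * b' * N (u' - v')"
    proof -
      have "(a + b) * (a * b * N (u - v)) = (a + b) * (a' * b' * N (u' - v'))"
        using W[folded r] by (simp only: ac_simps)
      then show ?thesis using nz(3) by (metis mult_left_cancel)
    qed
    have "S_part p = (b - a) * (a * b * N (u - v))" "S_part p = (b' - a') * (a' * b' * N (u' - v'))"
      using S_combination[of a u b v] S_combination[of a' u' b' v'] p p' by (simp_all add: algebra_simps)
    then have "b - a = b' - a'" using W' nz by (metis mult_right_cancel mult_eq_0_iff)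
    have "2 * a = (a + b) - (b - a)" by simp
    also have "\<dots> = (a' + b') - (b' - a')" by (simp only: r \<open>b - a = b' - a'\<close>)
    also have "\<dots> = 2 * a'" by simp
    finally have ab: "a = a'" "b = b'" using r by simp_all
    then have N: "N (u - v) = N (u' - v')" using W' nz by simp
    have "(a * b) *s F (u - v) = (a * b) *s F (u' - v')"
      using Y_combination[of a u b v] Y_combination[of a' u' b' v'] p p' ab by simp
    then have "F (u - v) = F (u' - v')" using nz vec.scale_left_imp_eq mult_eq_0_iff by metis
    then have "N (u - v) *s (u - v) = N (u - v) *s (u' - v')" using GF[of "u - v"] GF[of "u' - v'"] N by simp
    then have d: "u - v = u' - v'" using nz vec.scale_left_imp_eq by metis
    have "(a + b) *s v + a *s (u - v) = (a + b) *s v' + a *s (u' - v')"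
      using arg_cong[OF p, of x_of] arg_cong[OF p', of x_of] ab by (simp add: vec_eq_iff algebra_simps)
    then have "(a + b) *s v = (a + b) *s v'" unfolding d by (rule add_right_imp_eq)
    from vec.scale_left_imp_eq[OF nz(3) this] have "v = v'" .
    then show ?thesis using ab d by simp
  qed
  let ?W = "a * b * (a + b) * N (u - v)" and ?W' = "a' * b' * (a' + b') * N (u' - v')"
  have "?W\<^sup>2 = ?W'\<^sup>2"
    using disc_combination[of a u b v] disc_combination[of a' u' b' v'] assms(2,3) by simp
  then consider "?W = ?W'" | "?W = - ?W'" by (auto simp: power2_eq_iff)
  then show ?thesis
  proof cases
    case 1
    then show ?thesis using main[OF assms(2,3)] by blast
  next
    case 2
    \<comment> \<open>Exchanging the two points changes the sign of the square root.\<close>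
    have "N (v' - u') = - N (u' - v')" by (simp add: N_diff)
    then have "?W = b' * a' * (b' + a') * N (v' - u')" using 2 by (simp add: algebra_simps)
    moreover have "p = b' *s X v' + a' *s X u'" using assms(3) by (simp add: add.commute)
    ultimately show ?thesis using main[OF assms(2)] by blast
  qed
qed

text \<open>\<open>Phi\<close> replaces \<open>b\<close> by \<open>- b\<close> up to the factor
  \<open>k\<close>. Applied again it contributes \<open>- k\<close>, and the first factor enters
  cubed, so \<open>c = - k ^ 4\<close>.\<close>

lemma Phi_Phi:
  assumes "genericity p \<noteq> 0"
  obtains c where "c \<noteq> 0" "Phi (Phi p) = c *s p"
proof -
  obtain a b u v where p: "p = a *s X u + b *s X v" using secant_decomposition[OF assms] .
  define k where "k = a * b * N (u - v)"
  have "k \<noteq> 0" using generic_combination_nonzero[OF assms[unfolded p]] by (simp add: k_def)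
  have "Phi p = k *s (a *s X u + (- b) *s X v)"
    unfolding p Phi_combination k_def[symmetric] by (simp add: vector_smult_lneg)
  moreover have "Phi (a *s X u + (- b) *s X v) = (- k) *s p"
    unfolding p Phi_combination k_def by (simp add: vector_smult_lneg)
  ultimately have "Phi (Phi p) = (k ^ 3 * - k) *s p"
    by (simp only: Phi_scale vector_smult_assoc)
  then show thesis using that[of "k ^ 3 * - k"] \<open>k \<noteq> 0\<close> by simp
qed

text \<open>On the subspace \<open>y = 0\<close> two of the components are \<open>- r\<^sup>2 s - 2 N(x)\<close> and \<open>r s\<^sup>2\<close>, which are coprime. Hence
  a common factor \<open>h\<close> satisfies \<open>h(0) \<noteq> 0\<close>, and by homogeneity of \<open>\<Phi>\<close> it has no zero on the line
  joining \<open>0\<close> to a point at which \<open>\<Phi>\<close> does not vanish.\<close>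

lemma no_common_factor_Phi: "no_common_factor Phi"
  unfolding no_common_factor_def
proof (intro allI impI)
  fix h Q
  assume *: "poly_fun h \<and> (\<forall>i. poly_fun (Q i)) \<and> (\<forall>i p. Phi p $ i = h p * Q i p)"
  then have h: "poly_fun h" by blast
  have hnz: "h p \<noteq> 0" if "Phi p \<noteq> 0" for p
    using that * by (auto simp: vec_eq_iff)
  define q :: "complex \<Rightarrow> complex ^ 'n \<Rightarrow> complex \<Rightarrow> complex ^ 'n ambient"
    where "q r x s = ambient_vec r x 0 s" for r x s
  have q_line: "q r x s + c *s q r' x' s' = q (r + c * r') (x + c *s x') (s + c * s')" for c r x s r' x' s'
    by (simp add: q_def ambient_eq_iff)
  have Phi_q: "r_of (Phi (q r x s)) = - (r\<^sup>2 * s) - 2 * N x" "s_of (Phi (q r x s)) = r * s\<^sup>2" for r x s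
    using form_scale[OF t_form_left, of 0 0 x] form_scale[OF M3, of 0 0]
    by (simp_all add: Phi_def q_def defect_def power2_eq_square)
  \<comment> \<open>For \<open>N x\<close> nonzero the two components in \<open>Phi_q\<close> cannot
    vanish together, whatever \<open>r\<close> and \<open>s\<close> are.\<close>
  have h1: "h (q r x s) = h (q 0 x 0)" if "N x \<noteq> 0" for r x s
  proof -
    have "h (q 0 x 0 + c *s q r 0 s) \<noteq> 0" for c
    proof (rule hnz, rule notI)
      assume "Phi (q 0 x 0 + c *s q r 0 s) = 0"
      then have "Phi (q (c * r) x (c * s)) = 0" by (simp add: q_line)
      then have "- ((c * r)\<^sup>2 * (c * s)) - 2 * N x = 0" "(c * r) * (c * s)\<^sup>2 = 0"
        using Phi_q[of "c * r" x "c * s"] by simp_all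
      then show False using that by auto
    qed
    from poly_fun_nonvanishing_line[OF h this, of 1] show ?thesis unfolding q_line by simp
  qed
  obtain x\<^sub>0 where x\<^sub>0: "N x\<^sub>0 \<noteq> 0" using N_nonzero by blast
  define k where "k = h (q 1 0 1)"
  have "Phi (q 1 x 1) \<noteq> 0" for x
    using Phi_q(2)[of 1 x 1] by auto
  then have "h (q 1 0 1 + c *s q 0 x\<^sub>0 0) \<noteq> 0" for c by (intro hnz) (simp add: q_line)
  from poly_fun_nonvanishing_line[OF h this] have h2: "h (q 1 (c *s x\<^sub>0) 1) = k" for c
    by (simp add: q_line k_def)
  have "k \<noteq> 0" using hnz \<open>\<And>x. Phi (q 1 x 1) \<noteq> 0\<close> by (simp add: k_def)
  \<comment> \<open>On the ray through \<open>q 1 x\<^sub>0 1\<close>, \<open>h1\<close> and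
    \<open>h2\<close> give the value \<open>k\<close> away from the origin, hence also at the
    origin.\<close>
  obtain p where p: "\<And>c. h (0 + c *s q 1 x\<^sub>0 1) = poly p c" using poly_fun_line[OF h] by blast
  have "p = [:k:]"
  proof (rule poly_eq_off_zero)
    fix c :: complex assume "c \<noteq> 0"
    then have "N (c *s x\<^sub>0) \<noteq> 0" using x\<^sub>0 form_scale[OF N3] by simp
    then have "h (q c (c *s x\<^sub>0) c) = h (q 1 (c *s x\<^sub>0) 1)" using h1 by metis
    moreover have "c *s q 1 x\<^sub>0 1 = q c (c *s x\<^sub>0) c" by (simp add: q_def ambient_eq_iff)
    ultimately show "poly p c = poly [:k:] c" using h2 p[of c] by simp
  qed
  then have "h 0 \<noteq> 0" using p[of 0] \<open>k \<noteq> 0\<close> by simp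
  have h0: "h p = h 0" if "Phi p \<noteq> 0" for p
  proof -
    have "h (0 + c *s p) \<noteq> 0" for c
    proof (cases "c = 0")
      case False
      then show ?thesis using that by (intro hnz) (simp add: Phi_scale)
    qed (use \<open>h 0 \<noteq> 0\<close> in simp)
    from poly_fun_nonvanishing_line[OF h this, of 1] show ?thesis by simp
  qed
  have "Phi (q 1 0 1) \<noteq> 0" by fact
  then obtain i where i: "Phi (q 1 0 1) $ i \<noteq> 0" by (auto simp: vec_eq_iff)
  have "h p = h 0" for p
  proof (rule poly_fun_eq_on_dense[where x = p, OF h poly_fun.const form_poly_fun[OF form_3_Phi] i])
    show "h p = h 0" if "Phi p $ i \<noteq> 0" for p using h0 that by force
  qed
  then show "\<exists>c. \<forall>p. h p = c" by blast
qed

end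

section \<open>Projective lines, harmonic conjugates and general points\<close>

lemma proj_pt_scale: "w \<noteq> 0 \<Longrightarrow> c \<noteq> 0 \<Longrightarrow> proj_pt (c *s w) = proj_pt w"
  using proj_pt_eq_iff[of w "c *s w"] by auto

lemma cproj_cases:
  obtains w where "w \<noteq> 0" "p = proj_pt w"
  using rep_cproj_nonzero[of p] proj_pt_rep[of p] by metis

text \<open>The open set is the complement of one hypersurface; \<open>P 0 = 0\<close> ensures that
  \<open>w\<^sub>0\<close> represents a point. The converse lemma after this one extracts such a
  form from an arbitrary open set.\<close>

lemma for_generalI:
  assumes P: "form d P" "P 0 = 0" "P w\<^sub>0 \<noteq> 0" and Q: "\<And>w. w \<noteq> 0 \<Longrightarrow> P w \<noteq> 0 \<Longrightarrow> Q (proj_pt w)"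
  shows "for_general Q"
proof -
  let ?U = "{proj_pt w | w. w \<noteq> 0 \<and> P w \<noteq> 0}"
  have "- ?U = {proj_pt w | w. w \<noteq> 0 \<and> P w = 0}"
  proof (intro equalityI subsetI)
    fix p assume "p \<in> - ?U"
    then show "p \<in> {proj_pt w | w. w \<noteq> 0 \<and> P w = 0}" by (cases p rule: cproj_cases) blast
  next
    fix p assume "p \<in> {proj_pt w | w. w \<noteq> 0 \<and> P w = 0}"
    then obtain w where w: "p = proj_pt w" "w \<noteq> 0" "P w = 0" by blast
    have False if "p = proj_pt v" "v \<noteq> 0" "P v \<noteq> 0" for v
      using that w proj_pt_eq_iff[of w v] form_scale[OF P(1), of _ w] by auto
    then show "p \<in> - ?U" by blast
  qed
  then have "zariski_closed (- ?U)"
    unfolding zariski_closed_def using P(1) by (intro exI[of _ "{P}"]) auto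
  moreover have "proj_pt w\<^sub>0 \<in> ?U" using P by blast
  ultimately show ?thesis unfolding for_general_def using Q by blast
qed

lemma for_generalE:
  assumes "for_general Q"
  obtains d P w\<^sub>0 where "form d P" "P w\<^sub>0 \<noteq> 0" "w\<^sub>0 \<noteq> 0" "\<And>w. w \<noteq> 0 \<Longrightarrow> P w \<noteq> 0 \<Longrightarrow> Q (proj_pt w)"
proof -
  obtain U p S where U: "p \<in> U" "\<forall>p\<in>U. Q p" and S: "\<forall>P\<in>S. \<exists>d. form d P"
    "- U = {proj_pt x | x. x \<noteq> 0 \<and> (\<forall>P\<in>S. P x = 0)}"
    using assms unfolding for_general_def zariski_closed_def by blast
  obtain w\<^sub>0 where w\<^sub>0: "w\<^sub>0 \<noteq> 0" "p = proj_pt w\<^sub>0" by (rule cproj_cases)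
  have "proj_pt w\<^sub>0 \<notin> - U" using U w\<^sub>0 by simp
  then obtain P where P: "P \<in> S" "P w\<^sub>0 \<noteq> 0" using w\<^sub>0 unfolding S(2) by blast
  then obtain d where d: "form d P" using S(1) by blast
  have "proj_pt w \<in> U" if "w \<noteq> 0" "P w \<noteq> 0" for w
  proof (rule ccontr)
    assume "proj_pt w \<notin> U"
    then have "proj_pt w \<in> - U" by simp
    then obtain x where "proj_pt w = proj_pt x" "x \<noteq> 0" "P x = 0" unfolding S(2) using P(1) by auto
    then show False using that proj_pt_eq_iff[of x w] form_scale[OF d, of _ x] by auto
  qed
  then show thesis using that[OF d P(2) w\<^sub>0(1)] U(2) by blast
qed

section \<open>From the Cremona transformation to the algebraic identities\<close>

lemma radial_form:
  fixes H :: "complex ^ 'n \<Rightarrow> complex ^ 'n"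
  assumes H: "\<And>i. form (Suc d) (\<lambda>y. H y $ i)" and par: "\<And>i j y. H y $ i * y $ j = H y $ j * y $ i"
  obtains M where "form d M" "\<And>y. H y = M y *s y"
proof -
  define i :: 'n where "i = undefined"
  have l: "form 1 (\<lambda>y. y $ i)" "(axis i 1 :: complex ^ 'n) $ i \<noteq> 0"
    by (rule form_coord) simp
  \<comment> \<open>As \<open>H y\<close> is parallel to \<open>y\<close>, it stays in the
    hyperplane \<open>y $ i = 0\<close>; hence that coordinate divides
    \<open>H y $ i\<close>.\<close>
  have "H y $ i = 0" if "y $ i = 0" for y
  proof (cases "y = 0")
    case True
    then show ?thesis using form_scale[OF H[of i], of 0 y] by simp
  next
    case False
    then obtain j where "y $ j \<noteq> 0" by (auto simp: vec_eq_iff)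
    then show ?thesis using par[of y i j] that by simp
  qed
  then obtain M where M: "poly_fun M" "\<And>y. H y $ i = y $ i * M y"
    using linear_dvd_iff[OF l form_poly_fun[OF H]] unfolding poly_dvd_def by metis
  have "form d M"
    by (rule form_right_factor[OF l(1) _ M(1) l(2) M(2)]) (use H in simp)
  moreover have "H y $ j = M y * y $ j" for j y
  proof (rule poly_fun_mult_left_cancel[where x = y, OF form_poly_fun[OF H] _ form_poly_fun[OF l(1)] l(2)])
    show "y $ i * H y $ j = y $ i * (M y * y $ j)" for y
      using par[of y i j] unfolding M(2) by (simp only: ac_simps)
  qed (intro poly_fun.intros M(1))
  ultimately show thesis using that by (simp add: vec_eq_iff)
qed

text \<open>The cubic \<open>M\<close> comes from the other composition: \<open>F (G y)\<close> is
  parallel to \<open>y\<close> at general points, hence everywhere. General definedness of the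
  compositions makes \<open>N\<close> and \<open>M\<close> nonzero.\<close>

lemma quadro_quadric_exists:
  fixes f g :: "'n::finite cproj \<rightharpoonup> 'n cproj"
  assumes fg: "birational_inverse f g" and F: "is_lift 2 F f" and G: "is_lift 2 G g"
    and N: "form 3 N" and GF: "\<And>x. G (F x) = N x *s x"
  obtains M t where "quadro_quadric F G N M t"
proof -
  interpret F: quadratic_map F by unfold_locales (use F in \<open>simp add: is_lift_def\<close>)
  interpret G: quadratic_map G by unfold_locales (use G in \<open>simp add: is_lift_def\<close>)
  have f: "f (proj_pt w) = (if F w = 0 then None else Some (proj_pt (F w)))" if "w \<noteq> 0" for w
    using rational_map_of_proj_pt[of 2 F w] that F unfolding is_lift_def by blast
  have g: "g (proj_pt w) = (if G w = 0 then None else Some (proj_pt (G w)))" if "w \<noteq> 0" for w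
    using rational_map_of_proj_pt[of 2 G w] that G unfolding is_lift_def by blast
  have "for_general (\<lambda>p. (g \<circ>\<^sub>m f) p = Some p)" "for_general (\<lambda>p. (f \<circ>\<^sub>m g) p = Some p)"
    using fg by (simp_all add: birational_inverse_def)
  from for_generalE[OF this(1)] obtain d P w\<^sub>0 where "form d P" "P w\<^sub>0 \<noteq> 0" "w\<^sub>0 \<noteq> 0"
    "\<And>w. w \<noteq> 0 \<Longrightarrow> P w \<noteq> 0 \<Longrightarrow> (g \<circ>\<^sub>m f) (proj_pt w) = Some (proj_pt w)" by blast
  then have "(g \<circ>\<^sub>m f) (proj_pt w\<^sub>0) \<noteq> None" by simp
  then have "G (F w\<^sub>0) \<noteq> 0"
    using \<open>w\<^sub>0 \<noteq> 0\<close> by (auto simp: map_comp_def f g split: if_splits)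
  then have N0: "\<exists>x. N x \<noteq> 0" unfolding GF by auto
  from for_generalE[OF \<open>for_general (\<lambda>p. (f \<circ>\<^sub>m g) p = Some p)\<close>] obtain e P y\<^sub>0
    where P: "form e P" "P y\<^sub>0 \<noteq> 0" "y\<^sub>0 \<noteq> 0"
    and *: "\<And>w. w \<noteq> 0 \<Longrightarrow> P w \<noteq> 0 \<Longrightarrow> (f \<circ>\<^sub>m g) (proj_pt w) = Some (proj_pt w)" by blast
  have fgw: "\<exists>c. c \<noteq> 0 \<and> F (G w) = c *s w" if "w \<noteq> 0" "P w \<noteq> 0" for w
  proof -
    have "G w \<noteq> 0" "F (G w) \<noteq> 0" "proj_pt (F (G w)) = proj_pt w"
      using *[OF that] that(1) by (auto simp: map_comp_def f g split: if_splits)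
    then show ?thesis using proj_pt_eq_iff[of w "F (G w)"] that(1) by auto
  qed
  have FG_form: "form (Suc 3) (\<lambda>y. F (G y) $ i)" for i
    using form_compose[OF F.form_2 G.form_2, of i] by (simp add: eval_nat_numeral)
  have "F (G y) $ i * y $ j = F (G y) $ j * y $ i" for i j y
  proof (rule poly_fun_eq_on_dense[where x = y, OF _ _ form_poly_fun[OF P(1)] P(2)])
    fix y assume "P y \<noteq> 0"
    show "F (G y) $ i * y $ j = F (G y) $ j * y $ i"
    proof (cases "y = 0")
      case False
      then show ?thesis using fgw[OF _ \<open>P y \<noteq> 0\<close>] by auto
    qed simp
  qed (intro poly_fun.intros form_poly_fun[OF FG_form])+
  then obtain M where M: "form 3 M" "\<And>y. F (G y) = M y *s y"
    using radial_form[of 3 "\<lambda>y. F (G y)"] FG_form by blast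
  obtain c where "c \<noteq> 0" "F (G y\<^sub>0) = c *s y\<^sub>0" using fgw[OF P(3,2)] by blast
  then have "M y\<^sub>0 \<noteq> 0" using M(2)[of y\<^sub>0] P(3) by auto
  then interpret inverse_quadratic_pair F G N M
    by unfold_locales (use N M GF N0 in auto)
  obtain t where "\<And>u. form 1 (\<lambda>y. t y u)" "\<And>y. form 1 (t y)"
    "\<And>x u. cubic_deriv N x u = t (F x) u" "\<And>y v. cubic_deriv M y v = t v (G y)"
    "\<And>x v. polar F x (polar G (F x) v) = t v x *s F x + N x *s v"
    by (rule symmetric_trace_form_exists) (use F G in \<open>auto simp: is_lift_def\<close>)
  then have "quadro_quadric F G N M t" by unfold_locales
  then show thesis by (rule that)
qed

section \<open>Projective lines and cross-ratios\<close>

lemma independent_pair_iff: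
  fixes u v :: "complex ^ 'n"
  shows "u \<noteq> v \<and> vec.independent {u, v} \<longleftrightarrow> (\<forall>a b. a *s u + b *s v = 0 \<longrightarrow> a = 0 \<and> b = 0)"
proof
  assume uv: "u \<noteq> v \<and> vec.independent {u, v}"
  then have "u \<noteq> v" "v \<noteq> u" by blast+
  show "\<forall>a b. a *s u + b *s v = 0 \<longrightarrow> a = 0 \<and> b = 0"
  proof (intro allI impI)
    fix a b assume ab: "a *s u + b *s v = 0"
    let ?c = "\<lambda>w. if w = u then a else b"
    have "(\<Sum>w\<in>{u, v}. ?c w *s w) = ?c u *s u + ?c v *s v"
      by (subst sum.insert) (use \<open>u \<noteq> v\<close> in simp_all)
    also have "\<dots> = 0" using ab \<open>v \<noteq> u\<close> by simp
    finally have sum: "(\<Sum>w\<in>{u, v}. ?c w *s w) = 0" .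
    have "\<not> (\<exists>w\<in>{u, v}. ?c w \<noteq> 0)"
    proof
      assume "\<exists>w\<in>{u, v}. ?c w \<noteq> 0"
      with sum have "vec.dependent {u, v}"
        by (subst vec.dependent_finite) (auto intro!: exI[of _ ?c] simp del: sum.insert)
      then show False using uv by blast
    qed
    then have "?c u = 0" "?c v = 0" by blast+
    then show "a = 0 \<and> b = 0" using \<open>u \<noteq> v\<close> by (simp split: if_splits)
  qed
next
  assume *: "\<forall>a b. a *s u + b *s v = 0 \<longrightarrow> a = 0 \<and> b = 0"
  have "u \<noteq> v"
  proof
    assume "u = v"
    then have "1 *s u + (- 1) *s v = 0" by (simp add: vector_smult_lneg)
    from *[rule_format, OF this] show False by simp
  qed
  moreover have "vec.independent {u, v}"
  proof
    assume "vec.dependent {u, v}"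
    then obtain c where c: "\<exists>w\<in>{u, v}. c w \<noteq> 0" "(\<Sum>w\<in>{u, v}. c w *s w) = 0"
      using vec.dependent_finite[of "{u, v}"] by blast
    have "(\<Sum>w\<in>{u, v}. c w *s w) = c u *s u + c v *s v"
      by (subst sum.insert) (use \<open>u \<noteq> v\<close> in simp_all)
    then have "c u = 0 \<and> c v = 0" using * c(2) by metis
    then show False using c(1) by blast
  qed
  ultimately show "u \<noteq> v \<and> vec.independent {u, v}" ..
qed

lemma mem_proj_line_iff:
  assumes "u \<noteq> 0" "v \<noteq> 0" "w \<noteq> 0"
  shows "proj_pt w \<in> proj_line (proj_pt u) (proj_pt v) \<longleftrightarrow> (\<exists>a b. w = a *s u + b *s v)"
proof
  assume "proj_pt w \<in> proj_line (proj_pt u) (proj_pt v)"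
  then obtain u' v' w' where *: "u' \<noteq> 0" "v' \<noteq> 0" "proj_pt u = proj_pt u'" "proj_pt v = proj_pt v'"
    "proj_pt w = proj_pt w'" "w' \<noteq> 0" "w' \<in> vec.span {u', v'}"
    unfolding proj_line_def by blast
  then obtain c d e where "u' = c *s u" "v' = d *s v" "w = e *s w'"
    using proj_pt_eq_iff[of u u'] proj_pt_eq_iff[of v v'] proj_pt_eq_iff[of w' w] assms by auto
  moreover obtain a b where "w' = a *s u' + b *s v'"
    using *(7) by (auto simp: vec.span_insert vec.span_singleton algebra_simps)
  ultimately have "w = (e * a * c) *s u + (e * b * d) *s v"
    by (simp add: vector_add_ldistrib vector_smult_assoc mult.assoc)
  then show "\<exists>a b. w = a *s u + b *s v" by blast
next
  assume "\<exists>a b. w = a *s u + b *s v"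
  then have "w \<in> vec.span {u, v}"
    by (blast intro: vec.span_add vec.span_scale vec.span_base)
  then show "proj_pt w \<in> proj_line (proj_pt u) (proj_pt v)"
    unfolding proj_line_def using assms by blast
qed

text \<open>Representatives are normalized so that the third point is \<open>A + B\<close>. In any
  other basis all brackets are multiples of \<open>bracket za zb\<close>, and the scalars cancel.
  For \<open>b = 0\<close> both sides are 0 by the convention for division.\<close>

lemma cross_ratio_eq:
  assumes ind: "\<And>a b. a *s A + b *s B = 0 \<Longrightarrow> a = 0 \<and> b = 0" and ab: "(a, b) \<noteq> (0, 0)"
  shows "cross_ratio (proj_pt A) (proj_pt B) (proj_pt (A + B)) (proj_pt (a *s A + b *s B)) = a / b"
  unfolding cross_ratio_def
proof (rule the_equality, goal_cases)
  case 1
  have "A \<noteq> B \<and> vec.independent {A, B}" using independent_pair_iff ind by blast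
  then show ?case using ab
    by (intro exI[of _ A] exI[of _ B] exI[of _ "(1, 0)"] exI[of _ "(0, 1)"] exI[of _ "(1, 1)"] exI[of _ "(a, b)"])
      (auto simp: bracket_def)
next
  case (2 k)
  have nz: "A \<noteq> 0" "B \<noteq> 0" "A + B \<noteq> 0" "a *s A + b *s B \<noteq> 0"
    using ind[of 1 0] ind[of 0 1] ind[of 1 1] ind[of a b] ab by auto
  obtain u v za zb zc zd where uv: "u \<noteq> v" "vec.independent {u, v}"
    and z: "za \<noteq> (0, 0)" "zb \<noteq> (0, 0)" "zc \<noteq> (0, 0)" "zd \<noteq> (0, 0)"
    and eq: "proj_pt A = proj_pt (fst za *s u + snd za *s v)"
      "proj_pt B = proj_pt (fst zb *s u + snd zb *s v)"
      "proj_pt (A + B) = proj_pt (fst zc *s u + snd zc *s v)"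
      "proj_pt (a *s A + b *s B) = proj_pt (fst zd *s u + snd zd *s v)"
    and k: "k = (bracket za zc * bracket zb zd) / (bracket za zd * bracket zb zc)"
    using 2 by blast
  have ind': "c = 0 \<and> d = 0" if "c *s u + d *s v = 0" for c d
    using independent_pair_iff[of u v] uv that by blast
  have rep: "\<exists>m. m \<noteq> 0 \<and> w = m *s (fst z *s u + snd z *s v)"
    if "w \<noteq> 0" "z \<noteq> (0, 0)" "proj_pt w = proj_pt (fst z *s u + snd z *s v)" for w z
  proof -
    have "fst z *s u + snd z *s v \<noteq> 0" using ind'[of "fst z" "snd z"] that(2) by (auto simp: prod_eq_iff)
    then show ?thesis using proj_pt_eq_iff[of "fst z *s u + snd z *s v" w] that by auto
  qed
  obtain l where l: "l \<noteq> 0" "A = l *s (fst za *s u + snd za *s v)" using rep[OF nz(1) z(1) eq(1)] by blast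
  obtain m where m: "m \<noteq> 0" "B = m *s (fst zb *s u + snd zb *s v)" using rep[OF nz(2) z(2) eq(2)] by blast
  obtain n where n: "n \<noteq> 0" "A + B = n *s (fst zc *s u + snd zc *s v)" using rep[OF nz(3) z(3) eq(3)] by blast
  obtain r where r: "r \<noteq> 0" "a *s A + b *s B = r *s (fst zd *s u + snd zd *s v)" using rep[OF nz(4) z(4) eq(4)] by blast
  have coords: "c = c' \<and> d = d'" if "c *s u + d *s v = c' *s u + d' *s v" for c d c' d'
  proof -
    have "(c - c') *s u + (d - d') *s v = 0"
      using that by (simp add: vec_eq_iff algebra_simps)
    then show ?thesis using ind' by fastforce
  qed
  have "(n * fst zc) *s u + (n * snd zc) *s v = (l * fst za + m * fst zb) *s u + (l * snd za + m * snd zb) *s v"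
    using n(2) unfolding l(2) m(2) by (simp add: vec_eq_iff algebra_simps)
  from coords[OF this] have zc: "n * fst zc = l * fst za + m * fst zb" "n * snd zc = l * snd za + m * snd zb" by auto
  have "(r * fst zd) *s u + (r * snd zd) *s v
      = (a * l * fst za + b * m * fst zb) *s u + (a * l * snd za + b * m * snd zb) *s v"
    using r(2) unfolding l(2) m(2) by (simp add: vec_eq_iff algebra_simps)
  from coords[OF this] have zd: "r * fst zd = a * l * fst za + b * m * fst zb"
    "r * snd zd = a * l * snd za + b * m * snd zb" by auto
  let ?\<beta> = "bracket za zb"
  have "?\<beta> \<noteq> 0"
  proof
    assume "?\<beta> = 0"
    then have "(m * snd zb) *s A + (- (l * snd za)) *s B = 0" "(m * fst zb) *s A + (- (l * fst za)) *s B = 0"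
      unfolding l(2) m(2) bracket_def by (simp_all add: vec_eq_iff algebra_simps)
    from ind[OF this(1)] ind[OF this(2)] have "snd za = 0" "fst za = 0" using l(1) by auto
    then show False using z(1) by (simp add: prod_eq_iff)
  qed
  have "n * bracket za zc = m * ?\<beta>"
  proof -
    have "n * bracket za zc = fst za * (n * snd zc) - (n * fst zc) * snd za" by (simp add: bracket_def algebra_simps)
    then show ?thesis unfolding zc by (simp add: bracket_def algebra_simps)
  qed
  moreover have "n * bracket zb zc = - (l * ?\<beta>)"
  proof -
    have "n * bracket zb zc = fst zb * (n * snd zc) - (n * fst zc) * snd zb" by (simp add: bracket_def algebra_simps)
    then show ?thesis unfolding zc by (simp add: bracket_def algebra_simps)
  qed
  moreover have "r * bracket za zd = b * m * ?\<beta>"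
  proof -
    have "r * bracket za zd = fst za * (r * snd zd) - (r * fst zd) * snd za" by (simp add: bracket_def algebra_simps)
    then show ?thesis unfolding zd by (simp add: bracket_def algebra_simps)
  qed
  moreover have "r * bracket zb zd = - (a * l * ?\<beta>)"
  proof -
    have "r * bracket zb zd = fst zb * (r * snd zd) - (r * fst zd) * snd zb" by (simp add: bracket_def algebra_simps)
    then show ?thesis unfolding zd by (simp add: bracket_def algebra_simps)
  qed
  ultimately have "bracket za zc = m * ?\<beta> / n" "bracket zb zc = - (l * ?\<beta>) / n"
    "bracket za zd = b * m * ?\<beta> / r" "bracket zb zd = - (a * l * ?\<beta>) / r"
    using n(1) r(1) by (simp_all add: field_simps)
  then show ?case unfolding k using n(1) r(1) l(1) m(1) \<open>?\<beta> \<noteq> 0\<close> by simp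
qed

lemma harmonic_conjugate_eq:
  assumes ind: "\<And>a b. a *s A + b *s B = 0 \<Longrightarrow> a = 0 \<and> b = 0"
  shows "harmonic_conjugate (proj_pt A) (proj_pt B) (proj_pt (A + B)) = proj_pt (A - B)"
  unfolding harmonic_conjugate_def
proof (rule the_equality)
  have nz: "A \<noteq> 0" "B \<noteq> 0" "A - B \<noteq> 0"
    using ind[of 1 0] ind[of 0 1] ind[of 1 "-1"] by (auto simp: vector_smult_lneg)
  have diff: "A - B = 1 *s A + (-1) *s B" by (simp add: vector_smult_lneg)
  have "proj_pt (A - B) \<in> proj_line (proj_pt A) (proj_pt B)"
    unfolding mem_proj_line_iff[OF nz] using diff by blast
  moreover have "cross_ratio (proj_pt A) (proj_pt B) (proj_pt (A + B)) (proj_pt (A - B)) = 1 / (- 1)"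
    unfolding diff by (rule cross_ratio_eq[OF ind]) auto
  ultimately show "proj_pt (A - B) \<in> proj_line (proj_pt A) (proj_pt B) \<and>
      cross_ratio (proj_pt A) (proj_pt B) (proj_pt (A + B)) (proj_pt (A - B)) = - 1" by simp
  fix q
  assume q: "q \<in> proj_line (proj_pt A) (proj_pt B) \<and>
      cross_ratio (proj_pt A) (proj_pt B) (proj_pt (A + B)) q = - 1"
  obtain w where w: "w \<noteq> 0" "q = proj_pt w" by (rule cproj_cases)
  then obtain a b where ab: "w = a *s A + b *s B" using q mem_proj_line_iff[OF nz(1,2)] by blast
  then have "(a, b) \<noteq> (0, 0)" using w(1) by auto
  from cross_ratio_eq[of A B, OF ind this] have "a / b = - 1" using q unfolding w(2) ab by simp
  \<comment> \<open>Division by zero yields 0, not \<open>- 1\<close>.\<close>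
  then have "b \<noteq> 0" by auto
  with \<open>a / b = - 1\<close> have "a = - b" by (simp add: divide_eq_eq)
  then have "w = a *s (A - B)" "a \<noteq> 0" unfolding ab using \<open>b \<noteq> 0\<close> by (simp_all add: vec_eq_iff algebra_simps)
  then show "q = proj_pt (A - B)" using w(2) proj_pt_scale nz(3) by blast
qed

text \<open>The hypersurface of \<open>P\<close> is one of the closed sets intersected in the
  closure.\<close>

lemma closure_vanishing:
  assumes "form d P" "\<And>x. P (X_param F N x) = 0" "w \<noteq> 0" "proj_pt w \<in> X_variety F N"
  shows "P w = 0"
proof -
  let ?Z = "{proj_pt x | x. x \<noteq> 0 \<and> P x = 0}"
  have "X_param F N x \<noteq> 0" for x by (auto simp: vec_eq_iff X_param_def intro!: exI[of _ "Inl ()"])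
  then have "range (\<lambda>x. proj_pt (X_param F N x)) \<subseteq> ?Z" using assms(2) by blast
  moreover have "zariski_closed ?Z"
    unfolding zariski_closed_def using assms(1) by (intro exI[of _ "{P}"]) auto
  ultimately have "proj_pt w \<in> ?Z" using assms(4) unfolding X_variety_def zariski_closure_def by blast
  then obtain x where "proj_pt w = proj_pt x" "x \<noteq> 0" "P x = 0" by blast
  then show ?thesis using proj_pt_eq_iff[of x w] assms(3) form_scale[OF assms(1), of _ x] by auto
qed

lemma X_param_mem: "proj_pt (X_param F N x) \<in> X_variety F N"
  unfolding X_variety_def zariski_closure_def by blast

section \<open>Secants of the variety\<close>

context quadro_quadric
begin

lemma X_nonzero: "X u \<noteq> 0"
  using X_param_parts(1)[of F N u] by (metis parts_linear(13) zero_neq_one)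

lemma X_independent:
  assumes "u \<noteq> v" "a *s X u + b *s X v = 0"
  shows "a = 0 \<and> b = 0"
proof -
  have r: "a + b = 0" and x: "a *s u + b *s v = 0"
    using arg_cong[OF assms(2), of r_of] arg_cong[OF assms(2), of x_of] by simp_all
  from r have b: "b = - a" by (simp add: eq_neg_iff_add_eq_0 add.commute)
  have "a *s (u - v) = 0" using x unfolding b by (simp add: vec_eq_iff algebra_simps)
  then show ?thesis using assms(1) b by simp
qed

text \<open>At \<open>w = X(u)\<close> both sides of the third equation are \<open>N(u - v)\<^sup>2\<close>. It is what excludes secants
  through points at infinity.\<close>

lemma closure_equations:
  assumes w: "w \<noteq> 0" "proj_pt w \<in> X_variety F N"
  shows "r_of w *s y_of w = F (x_of w)" "(r_of w)\<^sup>2 * s_of w = N (x_of w)"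
    "M (r_of w *s F v + y_of w - polar F (x_of w) v)
       = r_of w * (s_of w - t (y_of w) v + t (F v) (x_of w) - r_of w * N v)\<^sup>2"
proof -
  have "r_of w * y_of w $ i - F (x_of w) $ i = 0" for i
  proof (rule closure_vanishing[OF _ _ w])
    have "form (1 + 1) (\<lambda>w. r_of w * y_of w $ i)" by (intro form_mult form_parts)
    moreover have "form (1 * 2) (\<lambda>w. F (x_of w) $ i)" by (rule form_compose[OF F.form_2 form_parts(3)])
    ultimately show "form 2 (\<lambda>w. r_of w * y_of w $ i - F (x_of w) $ i)"
      by (intro form_diff) (simp_all add: numeral_2_eq_2)
  qed simp
  then show "r_of w *s y_of w = F (x_of w)" by (simp add: vec_eq_iff)
  have "(r_of w)\<^sup>2 * s_of w - N (x_of w) = 0"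
  proof (rule closure_vanishing[OF _ _ w])
    have "form (1 * 2 + 1) (\<lambda>w. (r_of w)\<^sup>2 * s_of w)" by (intro form_mult form_power form_parts)
    moreover have "form (1 * 3) (\<lambda>w. N (x_of w))" by (rule form_compose[OF N3 form_parts(3)])
    ultimately show "form 3 (\<lambda>w. (r_of w)\<^sup>2 * s_of w - N (x_of w))"
      by (intro form_diff) (simp_all add: eval_nat_numeral)
  qed simp
  then show "(r_of w)\<^sup>2 * s_of w = N (x_of w)" by simp
  let ?Y = "\<lambda>w. r_of w *s F v + y_of w - polar F (x_of w) v"
  let ?S = "\<lambda>w. s_of w - t (y_of w) v + t (F v) (x_of w) - r_of w * N v"
  have "M (?Y w) - r_of w * (?S w)\<^sup>2 = 0"
  proof (rule closure_vanishing[OF _ _ w])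
    have "form 1 (\<lambda>w. ?Y w $ i)" for i
      unfolding form_def
      by (auto intro!: poly_fun_intros poly_fun_parts F.poly_fun_polar simp: F.polar_scale_left algebra_simps)
    then have "form (1 * 3) (\<lambda>w. M (?Y w))" by (rule form_compose[OF M3])
    moreover have "form 1 ?S"
      unfolding form_def
      by (auto intro!: poly_fun_intros poly_fun_parts poly_fun_t simp: t_bilinear algebra_simps)
    then have "form (1 + 1 * 2) (\<lambda>w. r_of w * (?S w)\<^sup>2)" by (intro form_mult form_power form_parts)
    ultimately show "form 3 (\<lambda>w. M (?Y w) - r_of w * (?S w)\<^sup>2)"
      by (intro form_diff) (simp_all add: eval_nat_numeral)
    show "M (?Y (X u)) - r_of (X u) * (?S (X u))\<^sup>2 = 0" for u
    proof -
      have "?Y (X u) = F (u - v)" "?S (X u) = N (u - v)" by (simp_all add: F_diff N_diff algebra_simps)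
      then show ?thesis using M_F[of "u - v"] by simp
    qed
  qed
  then show "M (?Y w) = r_of w * (?S w)\<^sup>2" by simp
qed

text \<open>By the first two closure equations, the closure adds no points to the image where
  \<open>r_of\<close> is nonzero.\<close>

lemma affine_point:
  assumes "w \<noteq> 0" "proj_pt w \<in> X_variety F N" "r_of w \<noteq> 0"
  obtains u where "w = r_of w *s X u"
proof
  note eqs = closure_equations(1,2)[OF assms(1,2)]
  show "w = r_of w *s X ((1 / r_of w) *s x_of w)"
    unfolding ambient_eq_iff parts_linear X_param_parts F.scale form_scale[OF N3] eqs[symmetric]
    using assms(3) by (simp add: vector_smult_assoc field_simps eval_nat_numeral)
qed

lemma generic_not_mem_X:
  assumes "w \<noteq> 0" "genericity w \<noteq> 0"
  shows "proj_pt w \<notin> X_variety F N"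
proof
  assume "proj_pt w \<in> X_variety F N"
  then have "Y_part w = 0" using closure_equations(1)[OF assms(1)] by (simp add: Y_part_def)
  then show False using assms(2) form_scale[OF M3, of 0 0] by (simp add: genericity_def)
qed

text \<open>\<open>Y_part\<close> of the secant point is \<open>b\<close> times the vector on which
  the third closure equation, with \<open>r_of A = 0\<close>, makes \<open>M\<close> vanish.\<close>

lemma secant_point_at_infinity:
  assumes "A \<noteq> 0" "proj_pt A \<in> X_variety F N" "r_of A = 0"
  shows "genericity (A + b *s X v) = 0"
proof -
  have F0: "F (x_of A) = 0" using closure_equations(1)[OF assms(1,2)] assms(3) by simp
  have M0: "M (y_of A - polar F (x_of A) v) = 0"
    using closure_equations(3)[OF assms(1,2), of v] assms(3) by simp
  have "Y_part (A + b *s X v) = b *s (y_of A - polar F (x_of A) v)"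
    using assms(3) by (simp add: Y_part_def F.add_scale F0 vec_eq_iff algebra_simps power2_eq_square)
  then have "M (Y_part (A + b *s X v)) = 0" by (simp only: form_scale[OF M3] M0 mult_zero_right)
  then show ?thesis by (simp add: genericity_def)
qed

lemma secant_pairs_eq:
  assumes genericity: "genericity w \<noteq> 0" and w: "w = a *s X u + b *s X v"
  shows "secant_pairs (X_variety F N) (proj_pt w) = {{proj_pt (X u), proj_pt (X v)}}"
proof -
  note nz = generic_combination_nonzero[OF genericity[unfolded w]]
  have w0: "w \<noteq> 0" using genericity genericity_0 by auto
  have "u \<noteq> v" using nz form_scale[OF N3, of 0 0] by auto
  have "proj_pt (X u) \<noteq> proj_pt (X v)"
  proof
    assume "proj_pt (X u) = proj_pt (X v)"
    then obtain c where "X v = c *s X u" using proj_pt_eq_iff[OF X_nonzero X_nonzero] by blast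
    then have "c *s X u + (- 1) *s X v = 0" by (simp add: vector_smult_lneg)
    then show False using X_independent[OF \<open>u \<noteq> v\<close>] by fastforce
  qed
  moreover have "proj_pt w \<in> proj_line (proj_pt (X u)) (proj_pt (X v))"
    using mem_proj_line_iff[OF X_nonzero X_nonzero w0] w by blast
  ultimately have 1: "{proj_pt (X u), proj_pt (X v)} \<in> secant_pairs (X_variety F N) (proj_pt w)"
    unfolding secant_pairs_def using X_param_mem by blast
  have 2: "{p, q} = {proj_pt (X u), proj_pt (X v)}"
    if pq: "p \<in> X_variety F N" "q \<in> X_variety F N" "proj_pt w \<in> proj_line p q" for p q
  proof -
    obtain p' where p': "p' \<noteq> 0" "p = proj_pt p'" by (rule cproj_cases)
    obtain q' where q': "q' \<noteq> 0" "q = proj_pt q'" by (rule cproj_cases)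
    obtain c d where cd: "w = c *s p' + d *s q'"
      using pq(3) mem_proj_line_iff[OF p'(1) q'(1) w0] unfolding p'(2) q'(2) by blast
    have "c \<noteq> 0"
    proof
      assume "c = 0"
      then have "w = d *s q'" "d \<noteq> 0" using cd w0 by auto
      then have "proj_pt w = q" using q' proj_pt_scale by metis
      then show False using generic_not_mem_X[OF w0 genericity] pq(2) by simp
    qed
    have "d \<noteq> 0"
    proof
      assume "d = 0"
      then have "w = c *s p'" "c \<noteq> 0" using cd w0 by auto
      then have "proj_pt w = p" using p' proj_pt_scale by metis
      then show False using generic_not_mem_X[OF w0 genericity] pq(1) by simp
    qed
    define A B where "A = c *s p'" and "B = d *s q'"
    have A: "A \<noteq> 0" "proj_pt A = p" and B: "B \<noteq> 0" "proj_pt B = q"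
      using \<open>c \<noteq> 0\<close> \<open>d \<noteq> 0\<close> p' q' proj_pt_scale by (auto simp: A_def B_def)
    note AX = A(1) pq(1)[folded A(2)] and BX = B(1) pq(2)[folded B(2)]
    have wAB: "w = A + B" using cd by (simp add: A_def B_def)
    have "r_of w \<noteq> 0" using genericity by (auto simp: genericity_def)
    \<comment> \<open>At most one end of the secant is at infinity; the other is then affine and
      \<open>secant_point_at_infinity\<close> applies.\<close>
    then have r_sum: "r_of A + r_of B \<noteq> 0" by (simp add: wAB)
    have rA: "r_of A \<noteq> 0"
    proof
      assume 0: "r_of A = 0"
      then obtain v' where "B = r_of B *s X v'" using affine_point[OF BX] r_sum by auto
      then show False using secant_point_at_infinity[OF AX 0] genericity wAB by metis
    qed
    have rB: "r_of B \<noteq> 0"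
    proof
      assume 0: "r_of B = 0"
      then obtain v' where "A = r_of A *s X v'" using affine_point[OF AX] r_sum by auto
      then show False using secant_point_at_infinity[OF BX 0] genericity wAB by (metis add.commute)
    qed
    obtain u' where u': "A = r_of A *s X u'" using affine_point[OF AX rA] .
    obtain v' where v': "B = r_of B *s X v'" using affine_point[OF BX rB] .
    have "w = r_of A *s X u' + r_of B *s X v'" using wAB u' v' by simp
    then have "u = u' \<and> v = v' \<or> u = v' \<and> v = u'"
      using secant_decomposition_unique[OF genericity w] by blast
    moreover have "p = proj_pt (X u')" using A(2) u' rA proj_pt_scale[OF X_nonzero rA] by metis
    moreover have "q = proj_pt (X v')" using B(2) v' rB proj_pt_scale[OF X_nonzero rB] by metis
    ultimately show ?thesis by blast
  qed
  show ?thesis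
  proof (intro equalityI subsetI)
    fix s assume "s \<in> secant_pairs (X_variety F N) (proj_pt w)"
    then show "s \<in> {{proj_pt (X u), proj_pt (X v)}}"
      unfolding secant_pairs_def using 2 by blast
  qed (use 1 in simp)
qed

lemma secant_harmonic_map_eq:
  assumes genericity: "genericity w \<noteq> 0"
  shows "secant_harmonic_map (X_variety F N) (proj_pt w) = Some (proj_pt (Phi w))"
proof -
  obtain a b u v where w: "w = a *s X u + b *s X v" using secant_decomposition[OF genericity] .
  note nz = generic_combination_nonzero[OF genericity[unfolded w]]
  have "u \<noteq> v" using nz form_scale[OF N3, of 0 0] by auto
  define A B where "A = a *s X u" and "B = b *s X v"
  have wAB: "w = A + B" by (simp add: w A_def B_def)
  have ind: "c = 0 \<and> d = 0" if "c *s A + d *s B = 0" for c d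
    using X_independent[OF \<open>u \<noteq> v\<close>, of "c * a" "d * b"] that nz
    by (simp add: A_def B_def vector_smult_assoc)
  have ind': "c = 0 \<and> d = 0" if "c *s B + d *s A = 0" for c d
    using ind[of d c] that by (simp add: add.commute)
  have "A - B \<noteq> 0" using ind[of 1 "-1"] by (auto simp: vector_smult_lneg)
  have AB: "proj_pt A = proj_pt (X u)" "proj_pt B = proj_pt (X v)"
    using proj_pt_scale[OF X_nonzero] nz by (simp_all add: A_def B_def)
  have "Phi w = (a * b * N (u - v)) *s (A - B)"
    unfolding w A_def B_def by (rule Phi_combination)
  then have Phi: "proj_pt (Phi w) = proj_pt (A - B)"
    using proj_pt_scale[OF \<open>A - B \<noteq> 0\<close>] nz by simp
  \<comment> \<open>Both orders of the pair yield the same conjugate, as the definite description in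
    \<open>secant_harmonic_map\<close> requires.\<close>
  have "proj_pt (B - A) = proj_pt (A - B)"
    using proj_pt_scale[OF \<open>A - B \<noteq> 0\<close>, of "- 1"] by (simp add: vector_smult_lneg)
  moreover have "harmonic_conjugate (proj_pt A) (proj_pt B) (proj_pt w) = proj_pt (A - B)"
    unfolding wAB by (rule harmonic_conjugate_eq[OF ind])
  moreover have "harmonic_conjugate (proj_pt B) (proj_pt A) (proj_pt w) = proj_pt (B - A)"
    unfolding wAB add.commute[of A B] by (rule harmonic_conjugate_eq[OF ind'])
  moreover have "secant_pairs (X_variety F N) (proj_pt w) = {{proj_pt A, proj_pt B}}"
    using secant_pairs_eq[OF genericity w] by (simp add: AB)
  ultimately have pairs: "secant_pairs (X_variety F N) (proj_pt w) = {{proj_pt A, proj_pt B}}"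
    and conj: "\<And>p q. {p, q} = {proj_pt A, proj_pt B} \<Longrightarrow> harmonic_conjugate p q (proj_pt w) = proj_pt (A - B)"
    unfolding doubleton_eq_iff by metis+
  have "(THE q. \<exists>p p'. {p, p'} \<in> secant_pairs (X_variety F N) (proj_pt w)
      \<and> q = harmonic_conjugate p p' (proj_pt w)) = proj_pt (A - B)"
    unfolding pairs
  proof (rule the_equality)
    show "\<exists>p p'. {p, p'} \<in> {{proj_pt A, proj_pt B}} \<and> proj_pt (A - B) = harmonic_conjugate p p' (proj_pt w)"
      using conj[of "proj_pt A" "proj_pt B"] by (metis singletonI)
  qed (use conj in auto)
  moreover have "\<exists>!s. s \<in> secant_pairs (X_variety F N) (proj_pt w)" unfolding pairs by blast
  ultimately show ?thesis by (simp add: secant_harmonic_map_def Phi)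
qed

text \<open>If \<open>Phi w\<close> were 0, so would be \<open>Phi (Phi w)\<close>, a nonzero
  multiple of \<open>w\<close>.\<close>

lemma Phi_nonzero: "genericity w \<noteq> 0 \<Longrightarrow> Phi w \<noteq> 0"
proof
  assume genericity: "genericity w \<noteq> 0" and "Phi w = 0"
  have "w \<noteq> 0" using genericity genericity_0 by auto
  obtain c where "c \<noteq> 0" "Phi (Phi w) = c *s w" using Phi_Phi[OF genericity] .
  moreover have "Phi 0 = 0" using Phi_scale[of 0 0] by simp
  ultimately show False using \<open>Phi w = 0\<close> \<open>w \<noteq> 0\<close> by simp
qed

lemma rational_map_of_Phi:
  "w \<noteq> 0 \<Longrightarrow> rational_map_of Phi (proj_pt w) = (if Phi w = 0 then None else Some (proj_pt (Phi w)))"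
  using rational_map_of_proj_pt[of 3 Phi w] form_3_Phi by blast

lemma for_general_if_generic:
  assumes "\<And>w. w \<noteq> 0 \<Longrightarrow> genericity w \<noteq> 0 \<Longrightarrow> Q (proj_pt w)"
  shows "for_general Q"
proof -
  obtain w\<^sub>0 where "genericity w\<^sub>0 \<noteq> 0" using genericity_nonzero by blast
  then show ?thesis using for_generalI[OF form_genericity genericity_0] assms by blast
qed

lemma secant_harmonic_map_rational:
  "for_general (\<lambda>p. \<exists>q. secant_harmonic_map (X_variety F N) p = Some q \<and> rational_map_of Phi p = Some q)"
  by (rule for_general_if_generic) (simp add: secant_harmonic_map_eq rational_map_of_Phi Phi_nonzero)

lemma Phi_involution: "birational_inverse (rational_map_of Phi) (rational_map_of Phi)"
proof -
  have "for_general (\<lambda>p. (rational_map_of Phi \<circ>\<^sub>m rational_map_of Phi) p = Some p)"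
  proof (rule for_general_if_generic)
    fix w assume w: "w \<noteq> 0" "genericity w \<noteq> 0"
    obtain c where "c \<noteq> 0" "Phi (Phi w) = c *s w" using Phi_Phi[OF w(2)] .
    then show "(rational_map_of Phi \<circ>\<^sub>m rational_map_of Phi) (proj_pt w) = Some (proj_pt w)"
      using w Phi_nonzero[OF w(2)] by (simp add: map_comp_def rational_map_of_Phi proj_pt_scale)
  qed
  then show ?thesis by (simp add: birational_inverse_def)
qed

lemma is_lift_Phi: "is_lift 3 Phi (rational_map_of Phi)"
  unfolding is_lift_def using form_3_Phi no_common_factor_Phi by blast

end

theorem proposition2p3:
  fixes f g :: "'n::finite cproj \<rightharpoonup> 'n cproj"
    and F G :: "complex ^ 'n \<Rightarrow> complex ^ 'n"
    and N :: "complex ^ 'n \<Rightarrow> complex"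
  assumes "CARD('n) \<ge> 3"
    and "f \<in> Bir 2 2"
    and "birational_inverse f g"
    and "is_lift 2 F f"
    and "is_lift 2 G g"
    and "form 3 N"
    and "\<forall>x. G (F x) = N x *s x"
  shows "\<exists>\<Phi> :: 'n ambient cproj \<rightharpoonup> 'n ambient cproj.
           for_general (\<lambda>p. \<exists>q. secant_harmonic_map (X_variety F N) p = Some q \<and> \<Phi> p = Some q)
         \<and> \<Phi> \<in> Bir 3 3
         \<and> birational_inverse \<Phi> \<Phi>"
proof -
  obtain M t where "quadro_quadric F G N M t"
    using quadro_quadric_exists[OF assms(3-6)] assms(7) by blast
  then interpret quadro_quadric F G N M t .
  \<comment> \<open>The map is its own birational inverse, so the single lift \<open>Phi\<close>
    provides both degrees.\<close>
  have "rational_map_of Phi \<in> Bir 3 3"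
    unfolding Bir_def using is_lift_Phi Phi_involution by blast
  then show ?thesis using secant_harmonic_map_rational Phi_involution by blast
qed

end
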